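(* Let $A=(\Sigma,G,\mathcal I)$ and $A'=(\Sigma,G',\mathcal I)$ be proto-algorithms (same alphabet and interpretation) with $\mathcal I=(D,D_{in},D_{out},I)$. If for all $d\in D_{in}$, $\vdash V_{[\mathrm{MEM}\mapsto d]}(\mathrm{gr2pr}_\Sigma(G))=V_{[\mathrm{MEM}\mapsto d]}(\mathrm{gr2pr}_\Sigma(G'))$, then $A\approx_a A'$.
   Context: Proto-algorithms. An alphabet is $\Sigma=(F,P)$, disjoint countable sets with $\mathsf{ini},\mathsf{fin}\in F$, $\widetilde F=F\setminus\{\mathsf{ini},\mathsf{fin}\}$. A $\Sigma$-algorithm graph is $(V,E,L_v,L_e,l,r)$: $V$ nonempty finite, $E\subseteq V\times V$, $L_v=F\cup P$, $L_e=\{0,1\}$, $l$ a partial labeling of vertices (into $L_v$) and edges (into $L_e$), root $r\in V$, such that for every vertex $v$: $l(v)=\mathsf{ini}$ iff $v=r$; if $l(v)=\mathsf{ini}$: indegree $0$, outdegree $1$, outgoing edge unlabeled; if $l(v)=\mathsf{fin}$: indegree $>0$, outdegree $0$; if $l(v)\in\widetilde F$: indegree $>0$, outdegree $1$, outgoing edge unlabeled; if $l(v)\in P$: indegree $>0$, outdegree $2$, the two outgoing edges labeled with different labels; every directed cycle (sequence $v_1\dots v_{n+1}$ of consecutive edges, $v_1,\dots,v_n$ distinct, $v_1=v_{n+1}$) contains a vertex labeled in $F$. A $\Sigma$-interpretation is $(D,D_{in},D_{out},I)$ with total computable $I(\mathsf{ini}):D_{in}\to D$, $I(\mathsf{fin}):D\to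 D_{out}$, $I(f):D\to D$ ($f\in\widetilde F$), $I(p):D\to\{0,1\}$ ($p\in P$), such that no proper subset of $D$ contains $I(\mathsf{ini})(D_{in})$ and is closed under all $I(f)$, $f\in\widetilde F$. A proto-algorithm is $(\Sigma,G,\mathcal I)$. Its algorithmic step function $\mathrm{astep}_A$ on $D_{in}\cup(V\times D)\cup D_{out}$: $\mathrm{astep}_A(d)=(v',I(\mathsf{ini})(d))$ for $d\in D_{in}$, $(r,v')\in E$; $\mathrm{astep}_A((v,d))=(v',I(o)(d))$ if $l(v)=o\in\widetilde F$, $(v,v')\in E$; $\mathrm{astep}_A((v,d))=(v',d)$ if $l(v)=p\in P$, $(v,v')\in E$, $I(p)(d)=l((v,v'))$; $\mathrm{astep}_A((v,d))=I(\mathsf{fin})(d)$ if $l(v)=\mathsf{fin}$; $\mathrm{astep}_A(d)=d$ for $d\in D_{out}$. Algorithmic equivalence: for $A$ with vertex set $V$, main domain $D$ and $A'$ with vertex set $V'$, main domain $D'$ (input/output domains $D_{in},D_{out}$ resp. $D'_{in},D'_{out}$), an algorithmic simulation of $A$ by $A'$ is $R\subseteq(D_{in}\times D'_{in})\cup((V\times D)\times(V'\times D'))\cup(D_{out}\times D'_{out})$ such that each $d\in D_{in}$ is related to a unique $d'\in D'_{in}$, for each $d'\in D'_{out}$ there is a unique $d\in D_{out}$ with $(d,d')\in R$, and $(d,d')\in R$ implies $(\mathrm{astep}_A(d),\mathrm{astep}_{A'}(d'))\in R$. $A\approx_a A'$ iff algorithmic simulations of $A$ by $A'$ and of $A'$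 by $A$ both exist. Data algebra. From $\Sigma$ and $\mathcal I$ one forms a signature with sorts $\mathrm{Data}$ and $\mathrm{Bool}$, constants $0,1$ of sort $\mathrm{Bool}$, a constant of sort $\mathrm{Data}$ for each element of $D_{in}$, unary operations $\mathsf{ini},\mathsf{fin}$ and $f\in\widetilde F$ of type $\mathrm{Data}\to\mathrm{Data}$, and $p\in P$ of type $\mathrm{Data}\to\mathrm{Bool}$; $\mathfrak D$ is a minimal algebra of this signature whose Data carrier is $D\cup D_{in}\cup D_{out}$, whose Bool carrier is $\{0,1\}$ ($0\neq1$), and in which each symbol is interpreted by some total extension of the corresponding $I(\cdot)$. Each element $d$ of the Data carrier is denoted by a fixed closed term also written $d$. Process algebra (deBPA$\delta\epsilon$ with recursion). Fix a finite set $\mathrm{Act}$ of basic actions and a set $\mathcal V$ of flexible variables containing $\mathrm{MEM}$. Data terms: terms over the data signature plus each flexible variable as a constant of sort Data. Condition terms: $e=e'$ (Data or Bool terms), $\mathsf{True}$, $\mathsf{False}$, $\neg\phi$, $\phi\wedge\psi$, $\phi\vee\psi$, $\phi\Rightarrow\psi$. Process terms: $a\in\mathrm{Act}$, $\delta$, $\epsilon$, $t+t'$, $t\cdot t'$, assignment $v:=e$, guarded command $\phi:\to t$, evaluation $V_\rho(t)$ for each flexible variable valuation $\rho$ (total map from $\mathcal V$ to closed terms of the data signature), and constants $\langle X\mid S\rangle$ for $S$ a linear recursive specification and $X\in\mathrm{vars}(S)$. Linear terms: $\delta$; $\phi:\to\epsilon$; $\phi:\to\alpha\cdot X$ with $\phi$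 closed condition, $\alpha$ atomic ($a\in\mathrm{Act}$ or $v:=e$ with $e$ a closed data term), $X$ a recursion variable; $t+t'$ for linear $t,t'\neq\delta$. A linear recursive specification is a set of equations $X=t_X$ with each $t_X$ linear and only variables among the left-hand sides occurring. $[\mathrm{MEM}\mapsto d]$ denotes a fixed valuation $\rho$ with $\rho(\mathrm{MEM})=d$; $\rho$ extends homomorphically to data and condition terms; $\rho[e/v]$ is $\rho$ updated at $v$ to $e$. $\vdash t=t'$ means derivability in equational logic from: A1 $x+y=y+x$; A2 $(x+y)+z=x+(y+z)$; A3 $x+x=x$; A4 $(x+y)\cdot z=x\cdot z+y\cdot z$; A5 $(x\cdot y)\cdot z=x\cdot(y\cdot z)$; A6 $x+\delta=x$; A7 $\delta\cdot x=\delta$; A8 $x\cdot\epsilon=x$; A9 $\epsilon\cdot x=x$; GC1 $\mathsf{True}:\to x=x$; GC2 $\mathsf{False}:\to x=\delta$; GC3 $\phi:\to\delta=\delta$; GC4 $\phi:\to(x+y)=\phi:\to x+\phi:\to y$; GC5 $\phi:\to x\cdot y=(\phi:\to x)\cdot y$; GC6 $\phi:\to(\psi:\to x)=(\phi\wedge\psi):\to x$; GC7 $(\phi\vee\psi):\to x=\phi:\to x+\psi:\to x$; V1 $V_\rho(\epsilon)=\epsilon$; V2 $V_\rho(a\cdot x)=a\cdot V_\rho(x)$; V3 $V_\rho(v:=e\cdot x)=v:=\rho(e)\cdot V_{\rho[\rho(e)/v]}(x)$; V4 $V_\rho(x+y)=V_\rho(x)+V_\rho(y)$; V5 $V_\rho(\phi:\to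 x)=\rho(\phi):\to V_\rho(x)$; IMP1 $e=e'$ whenever $\mathfrak D\models e=e'$; IMP2 $\phi=\psi$ whenever $\mathfrak D\models\phi\Leftrightarrow\psi$; RDP $\langle X\mid S\rangle=\langle t_X\mid S\rangle$ for $X=t_X\in S$ (replacing each $Y\in\mathrm{vars}(S)$ in $t_X$ by $\langle Y\mid S\rangle$); RSP: if terms substituted for the variables of $S$ satisfy all equations of $S$, then the term substituted for $X$ equals $\langle X\mid S\rangle$. Graph-to-process function: $\mathrm{gr2pr}_\Sigma(G)=\langle X\mid S\rangle$ where pairwise distinct recursion variables $X_v$ ($v\in V$) and further variables $X$, $X_\epsilon$ are chosen and $S$ consists exactly of: $X=\mathsf{True}:\to\mathrm{MEM}:=\mathsf{ini}(\mathrm{MEM})\cdot X_{v'}$ with $(r,v')\in E$; $X_v=\mathsf{True}:\to\mathrm{MEM}:=o(\mathrm{MEM})\cdot X_{v'}$ for $l(v)=o\in\widetilde F$, $(v,v')\in E$; $X_v=(p(\mathrm{MEM})=1):\to\mathrm{MEM}:=\mathrm{MEM}\cdot X_{v'}+(p(\mathrm{MEM})=0):\to\mathrm{MEM}:=\mathrm{MEM}\cdot X_{v''}$ for $l(v)=p\in P$, $l((v,v'))=1$, $l((v,v''))=0$; $X_v=\mathsf{True}:\to\mathrm{MEM}:=\mathsf{fin}(\mathrm{MEM})\cdot X_\epsilon$ for $l(v)=\mathsf{fin}$; $X_\epsilon=\mathsf{True}:\to\epsilon$. *)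

theory Defs
  imports "HOL-Library.Countable_Set"
begin

section \<open>Computability\<close>

datatype murec = Zero | Succ | Proj nat | Comp murec "murec list" | PrimRec murec murec | Mu murec

inductive mu_eval :: "murec \<Rightarrow> nat list \<Rightarrow> nat \<Rightarrow> bool" where
  zero: "mu_eval Zero xs 0"
| succ: "mu_eval Succ [x] (Suc x)"
| proj: "i < length xs \<Longrightarrow> mu_eval (Proj i) xs (xs ! i)"
| comp: "list_all2 (\<lambda>g y. mu_eval g xs y) gs ys \<Longrightarrow> mu_eval f ys z \<Longrightarrow> mu_eval (Comp f gs) xs z"
| prim_0: "mu_eval f xs y \<Longrightarrow> mu_eval (PrimRec f g) (0 # xs) y"
| prim_Suc: "mu_eval (PrimRec f g) (n # xs) y \<Longrightarrow> mu_eval g (n # y # xs) z \<Longrightarrow>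
    mu_eval (PrimRec f g) (Suc n # xs) z"
| mu: "mu_eval f (n # xs) 0 \<Longrightarrow> \<forall>m<n. \<exists>y. mu_eval f (m # xs) (Suc y) \<Longrightarrow> mu_eval (Mu f) xs n"

text \<open>
  A function on an abstract set is computable relative to codings of its domain and
  codomain by natural numbers: some partial recursive function maps the code of each
  argument to the code of the value.
\<close>

definition computable_on :: "'a set \<Rightarrow> ('a \<Rightarrow> nat) \<Rightarrow> ('b \<Rightarrow> nat) \<Rightarrow> ('a \<Rightarrow> 'b) \<Rightarrow> bool" where
  "computable_on A c c' f \<longleftrightarrow> (\<exists>\<phi>. \<forall>x\<in>A. mu_eval \<phi> [c x] (c' (f x)))"


section \<open>Proto-algorithms\<close>

record 's alphabet =
  funs :: "'s set"
  preds :: "'s set"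
  ini :: 's
  fin :: 's

definition alphabet :: "'s alphabet \<Rightarrow> bool" where
  "alphabet sg \<longleftrightarrow> countable (funs sg) \<and> countable (preds sg) \<and> funs sg \<inter> preds sg = {} \<and>
     ini sg \<in> funs sg \<and> fin sg \<in> funs sg \<and> ini sg \<noteq> fin sg"

definition inner_funs :: "'s alphabet \<Rightarrow> 's set" where
  "inner_funs sg = funs sg - {ini sg, fin sg}"

text \<open>The edge labels and the Boolean values 0 and 1 are \<^const>\<open>False\<close> and \<^const>\<open>True\<close>.\<close>

record ('s, 'v) agraph =
  verts :: "'v set"
  edges :: "('v \<times> 'v) set"
  vlab :: "'v \<Rightarrow> 's option"
  elab :: "'v \<times> 'v \<Rightarrow> bool option"
  root :: 'v

definition indeg :: "('s, 'v) agraph \<Rightarrow> 'v \<Rightarrow> nat" where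
  "indeg G v = card {u. (u, v) \<in> edges G}"

definition outdeg :: "('s, 'v) agraph \<Rightarrow> 'v \<Rightarrow> nat" where
  "outdeg G v = card {u. (v, u) \<in> edges G}"

definition out_unlabeled :: "('s, 'v) agraph \<Rightarrow> 'v \<Rightarrow> bool" where
  "out_unlabeled G v \<longleftrightarrow> (\<forall>u. (v, u) \<in> edges G \<longrightarrow> elab G (v, u) = None)"

definition is_cycle :: "('s, 'v) agraph \<Rightarrow> 'v list \<Rightarrow> bool" where
  "is_cycle G vs \<longleftrightarrow> length vs \<ge> 2 \<and> successively (\<lambda>u v. (u, v) \<in> edges G) vs \<and>
     distinct (butlast vs) \<and> hd vs = last vs"

definition algorithm_graph :: "'s alphabet \<Rightarrow> ('s, 'v) agraph \<Rightarrow> bool" where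
  "algorithm_graph sg G \<longleftrightarrow>
     finite (verts G) \<and> edges G \<subseteq> verts G \<times> verts G \<and> root G \<in> verts G \<and>
     dom (vlab G) \<subseteq> verts G \<and> ran (vlab G) \<subseteq> funs sg \<union> preds sg \<and> dom (elab G) \<subseteq> edges G \<and>
     (\<forall>v\<in>verts G.
        (vlab G v = Some (ini sg) \<longleftrightarrow> v = root G) \<and>
        (vlab G v = Some (ini sg) \<longrightarrow> indeg G v = 0 \<and> outdeg G v = 1 \<and> out_unlabeled G v) \<and>
        (vlab G v = Some (fin sg) \<longrightarrow> indeg G v > 0 \<and> outdeg G v = 0) \<and>
        (\<forall>f\<in>inner_funs sg. vlab G v = Some f \<longrightarrow>
            indeg G v > 0 \<and> outdeg G v = 1 \<and> out_unlabeled G v) \<and>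
        (\<forall>p\<in>preds sg. vlab G v = Some p \<longrightarrow>
            indeg G v > 0 \<and> outdeg G v = 2 \<and>
            (\<forall>u w. (v, u) \<in> edges G \<and> (v, w) \<in> edges G \<and> u \<noteq> w \<longrightarrow>
               elab G (v, u) \<noteq> None \<and> elab G (v, w) \<noteq> None \<and> elab G (v, u) \<noteq> elab G (v, w)))) \<and>
     (\<forall>vs. is_cycle G vs \<longrightarrow> (\<exists>v\<in>set vs. \<exists>f\<in>funs sg. vlab G v = Some f))"

text \<open>
  The interpretation of a symbol is only meaningful on its domain; the three domains live
  in one type since the data algebra below is built on their union.
\<close>

record ('s, 'd) interp =
  Dmain :: "'d set"
  Din :: "'d set"
  Dout :: "'d set"
  ifun :: "'s \<Rightarrow> 'd \<Rightarrow> 'd"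
  ipred :: "'s \<Rightarrow> 'd \<Rightarrow> bool"

definition computable_interp :: "'s alphabet \<Rightarrow> ('s, 'd) interp \<Rightarrow> bool" where
  "computable_interp sg I \<longleftrightarrow>
     (\<exists>c cin cout. inj_on c (Dmain I) \<and> inj_on cin (Din I) \<and> inj_on cout (Dout I) \<and>
        computable_on (Din I) cin c (ifun I (ini sg)) \<and>
        computable_on (Dmain I) c cout (ifun I (fin sg)) \<and>
        (\<forall>f\<in>inner_funs sg. computable_on (Dmain I) c c (ifun I f)) \<and>
        (\<forall>p\<in>preds sg. computable_on (Dmain I) c of_bool (ipred I p)))"

definition interpretation_of :: "'s alphabet \<Rightarrow> ('s, 'd) interp \<Rightarrow> bool" where
  "interpretation_of sg I \<longleftrightarrow>
     ifun I (ini sg) ` Din I \<subseteq> Dmain I \<and>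
     ifun I (fin sg) ` Dmain I \<subseteq> Dout I \<and>
     (\<forall>f\<in>inner_funs sg. ifun I f ` Dmain I \<subseteq> Dmain I) \<and>
     computable_interp sg I \<and>
     \<not> (\<exists>C. C \<subset> Dmain I \<and> ifun I (ini sg) ` Din I \<subseteq> C \<and> (\<forall>f\<in>inner_funs sg. ifun I f ` C \<subseteq> C))"

type_synonym ('s, 'v, 'd) proto_alg = "'s alphabet \<times> ('s, 'v) agraph \<times> ('s, 'd) interp"

definition proto_algorithm :: "('s, 'v, 'd) proto_alg \<Rightarrow> bool" where
  "proto_algorithm = (\<lambda>(sg, G, I). alphabet sg \<and> algorithm_graph sg G \<and> interpretation_of sg I)"


section \<open>Algorithmic equivalence\<close>

text \<open>
  Input states, internal states and output states are tagged, so that the step function is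
  well defined even if the input and output domains overlap. It is partial: no step is
  defined at internal states whose vertex is the root or is unlabeled.
\<close>

datatype ('v, 'd) state = StIn 'd | StMid 'v 'd | StOut 'd

fun astep :: "('s, 'v, 'd) proto_alg \<Rightarrow> ('v, 'd) state \<Rightarrow> ('v, 'd) state option" where
  "astep (sg, G, I) (StIn d) =
     Some (StMid (THE v'. (root G, v') \<in> edges G) (ifun I (ini sg) d))"
| "astep (sg, G, I) (StMid v d) =
     (case vlab G v of
        None \<Rightarrow> None
      | Some s \<Rightarrow>
          if s \<in> inner_funs sg then Some (StMid (THE v'. (v, v') \<in> edges G) (ifun I s d))
          else if s \<in> preds sg then
            Some (StMid (THE v'. (v, v') \<in> edges G \<and> elab G (v, v') = Some (ipred I s d)) d)
          else if s = fin sg then Some (StOut (ifun I (fin sg) d))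
          else None)"
| "astep (sg, G, I) (StOut d) = Some (StOut d)"

definition alg_simulation ::
  "('s, 'v, 'd) proto_alg \<Rightarrow> ('t, 'w, 'e) proto_alg \<Rightarrow> (('v, 'd) state \<times> ('w, 'e) state) set \<Rightarrow> bool"
where
  "alg_simulation = (\<lambda>(sg, G, I) (sg', G', I') R.
     R \<subseteq> (StIn ` Din I \<times> StIn ` Din I')
        \<union> ({StMid v d |v d. v \<in> verts G \<and> d \<in> Dmain I} \<times>
           {StMid v d |v d. v \<in> verts G' \<and> d \<in> Dmain I'})
        \<union> (StOut ` Dout I \<times> StOut ` Dout I') \<and>
     (\<forall>d\<in>Din I. \<exists>!d'. d' \<in> Din I' \<and> (StIn d, StIn d') \<in> R) \<and>
     (\<forall>d'\<in>Dout I'. \<exists>!d. d \<in> Dout I \<and> (StOut d, StOut d') \<in> R) \<and>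
     (\<forall>s s'. (s, s') \<in> R \<longrightarrow>
        (\<exists>t t'. astep (sg, G, I) s = Some t \<and> astep (sg', G', I') s' = Some t' \<and> (t, t') \<in> R)))"

definition alg_equiv ::
  "('s, 'v, 'd) proto_alg \<Rightarrow> ('t, 'w, 'e) proto_alg \<Rightarrow> bool" (infix "\<approx>\<^sub>a" 50)
where
  "A \<approx>\<^sub>a A' \<longleftrightarrow> (\<exists>R. alg_simulation A A' R) \<and> (\<exists>R. alg_simulation A' A R)"


section \<open>Data terms and the data algebra\<close>

text \<open>
  No operation takes an argument of sort Bool, so terms of the two sorts form separate
  types. \<open>DCon d\<close> is the constant for the input element \<open>d\<close>, \<open>DFlx v\<close> is a flexible variable.
\<close>

datatype ('s, 'd, 'm) dterm = DCon 'd | DFlx 'm | DApp 's "('s, 'd, 'm) dterm"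

datatype ('s, 'd, 'm) bterm = B0 | B1 | BApp 's "('s, 'd, 'm) dterm"

datatype ('s, 'd, 'm) cond =
    CEqD "('s, 'd, 'm) dterm" "('s, 'd, 'm) dterm"
  | CEqB "('s, 'd, 'm) bterm" "('s, 'd, 'm) bterm"
  | CTrue
  | CFalse
  | CNot "('s, 'd, 'm) cond"
  | CAnd "('s, 'd, 'm) cond" "('s, 'd, 'm) cond"
  | COr "('s, 'd, 'm) cond" "('s, 'd, 'm) cond"
  | CImp "('s, 'd, 'm) cond" "('s, 'd, 'm) cond"

fun wf_dterm :: "'s alphabet \<Rightarrow> ('s, 'd) interp \<Rightarrow> ('s, 'd, 'm) dterm \<Rightarrow> bool" where
  "wf_dterm sg I (DCon d) \<longleftrightarrow> d \<in> Din I"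
| "wf_dterm sg I (DFlx v) \<longleftrightarrow> True"
| "wf_dterm sg I (DApp f e) \<longleftrightarrow> f \<in> funs sg \<and> wf_dterm sg I e"

fun wf_bterm :: "'s alphabet \<Rightarrow> ('s, 'd) interp \<Rightarrow> ('s, 'd, 'm) bterm \<Rightarrow> bool" where
  "wf_bterm sg I B0 \<longleftrightarrow> True"
| "wf_bterm sg I B1 \<longleftrightarrow> True"
| "wf_bterm sg I (BApp p e) \<longleftrightarrow> p \<in> preds sg \<and> wf_dterm sg I e"

fun wf_cond :: "'s alphabet \<Rightarrow> ('s, 'd) interp \<Rightarrow> ('s, 'd, 'm) cond \<Rightarrow> bool" where
  "wf_cond sg I (CEqD e e') \<longleftrightarrow> wf_dterm sg I e \<and> wf_dterm sg I e'"
| "wf_cond sg I (CEqB b b') \<longleftrightarrow> wf_bterm sg I b \<and> wf_bterm sg I b'"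
| "wf_cond sg I CTrue \<longleftrightarrow> True"
| "wf_cond sg I CFalse \<longleftrightarrow> True"
| "wf_cond sg I (CNot \<phi>) \<longleftrightarrow> wf_cond sg I \<phi>"
| "wf_cond sg I (CAnd \<phi> \<psi>) \<longleftrightarrow> wf_cond sg I \<phi> \<and> wf_cond sg I \<psi>"
| "wf_cond sg I (COr \<phi> \<psi>) \<longleftrightarrow> wf_cond sg I \<phi> \<and> wf_cond sg I \<psi>"
| "wf_cond sg I (CImp \<phi> \<psi>) \<longleftrightarrow> wf_cond sg I \<phi> \<and> wf_cond sg I \<psi>"

text \<open>Terms of the data signature proper, i.e. without flexible variables.\<close>

fun closed_dterm :: "('s, 'd, 'm) dterm \<Rightarrow> bool" where
  "closed_dterm (DCon d) \<longleftrightarrow> True"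
| "closed_dterm (DFlx v) \<longleftrightarrow> False"
| "closed_dterm (DApp f e) \<longleftrightarrow> closed_dterm e"

text \<open>The Bool carrier is \<^typ>\<open>bool\<close>, and the constants for input elements denote themselves.\<close>

record ('s, 'd) dalg =
  dcarrier :: "'d set"
  dfun :: "'s \<Rightarrow> 'd \<Rightarrow> 'd"
  dpred :: "'s \<Rightarrow> 'd \<Rightarrow> bool"

definition data_algebra :: "'s alphabet \<Rightarrow> ('s, 'd) interp \<Rightarrow> ('s, 'd) dalg \<Rightarrow> bool" where
  "data_algebra sg I \<DD> \<longleftrightarrow>
     dcarrier \<DD> = Dmain I \<union> Din I \<union> Dout I \<and>
     (\<forall>f\<in>funs sg. dfun \<DD> f ` dcarrier \<DD> \<subseteq> dcarrier \<DD>) \<and>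
     (\<forall>d\<in>Din I. dfun \<DD> (ini sg) d = ifun I (ini sg) d) \<and>
     (\<forall>d\<in>Dmain I. dfun \<DD> (fin sg) d = ifun I (fin sg) d) \<and>
     (\<forall>f\<in>inner_funs sg. \<forall>d\<in>Dmain I. dfun \<DD> f d = ifun I f d) \<and>
     (\<forall>p\<in>preds sg. \<forall>d\<in>Dmain I. dpred \<DD> p d = ipred I p d) \<and>
     \<not> (\<exists>C. C \<subset> dcarrier \<DD> \<and> Din I \<subseteq> C \<and> (\<forall>f\<in>funs sg. dfun \<DD> f ` C \<subseteq> C))"

fun deval :: "('s, 'd) dalg \<Rightarrow> ('m \<Rightarrow> 'd) \<Rightarrow> ('s, 'd, 'm) dterm \<Rightarrow> 'd" where
  "deval \<DD> \<eta> (DCon d) = d"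
| "deval \<DD> \<eta> (DFlx v) = \<eta> v"
| "deval \<DD> \<eta> (DApp f e) = dfun \<DD> f (deval \<DD> \<eta> e)"

fun beval :: "('s, 'd) dalg \<Rightarrow> ('m \<Rightarrow> 'd) \<Rightarrow> ('s, 'd, 'm) bterm \<Rightarrow> bool" where
  "beval \<DD> \<eta> B0 = False"
| "beval \<DD> \<eta> B1 = True"
| "beval \<DD> \<eta> (BApp p e) = dpred \<DD> p (deval \<DD> \<eta> e)"

fun ceval :: "('s, 'd) dalg \<Rightarrow> ('m \<Rightarrow> 'd) \<Rightarrow> ('s, 'd, 'm) cond \<Rightarrow> bool" where
  "ceval \<DD> \<eta> (CEqD e e') \<longleftrightarrow> deval \<DD> \<eta> e = deval \<DD> \<eta> e'"
| "ceval \<DD> \<eta> (CEqB b b') \<longleftrightarrow> beval \<DD> \<eta> b = beval \<DD> \<eta> b'"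
| "ceval \<DD> \<eta> CTrue \<longleftrightarrow> True"
| "ceval \<DD> \<eta> CFalse \<longleftrightarrow> False"
| "ceval \<DD> \<eta> (CNot \<phi>) \<longleftrightarrow> \<not> ceval \<DD> \<eta> \<phi>"
| "ceval \<DD> \<eta> (CAnd \<phi> \<psi>) \<longleftrightarrow> ceval \<DD> \<eta> \<phi> \<and> ceval \<DD> \<eta> \<psi>"
| "ceval \<DD> \<eta> (COr \<phi> \<psi>) \<longleftrightarrow> ceval \<DD> \<eta> \<phi> \<or> ceval \<DD> \<eta> \<psi>"
| "ceval \<DD> \<eta> (CImp \<phi> \<psi>) \<longleftrightarrow> (ceval \<DD> \<eta> \<phi> \<longrightarrow> ceval \<DD> \<eta> \<psi>)"

text \<open>
  Validity in the data algebra: a condition with flexible variables is valid if it holds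
  for all values of these variables.
\<close>

definition dvalid :: "('s, 'd) dalg \<Rightarrow> ('s, 'd, 'm) cond \<Rightarrow> bool" where
  "dvalid \<DD> \<phi> \<longleftrightarrow> (\<forall>\<eta>. range \<eta> \<subseteq> dcarrier \<DD> \<longrightarrow> ceval \<DD> \<eta> \<phi>)"

type_synonym ('s, 'd, 'm) valuation = "'m \<Rightarrow> ('s, 'd, 'm) dterm"

definition wf_valuation :: "'s alphabet \<Rightarrow> ('s, 'd) interp \<Rightarrow> ('s, 'd, 'm) valuation \<Rightarrow> bool" where
  "wf_valuation sg I \<rho> \<longleftrightarrow> (\<forall>v. wf_dterm sg I (\<rho> v) \<and> closed_dterm (\<rho> v))"

text \<open>The condition on \<open>e\<close> to be a closed term denoting \<open>d\<close>; the environment is immaterial.\<close>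

definition denotes ::
  "'s alphabet \<Rightarrow> ('s, 'd) interp \<Rightarrow> ('s, 'd) dalg \<Rightarrow> ('s, 'd, 'm) dterm \<Rightarrow> 'd \<Rightarrow> bool"
where
  "denotes sg I \<DD> e d \<longleftrightarrow> wf_dterm sg I e \<and> closed_dterm e \<and> (\<forall>\<eta>. deval \<DD> \<eta> e = d)"

fun dsubst :: "('s, 'd, 'm) valuation \<Rightarrow> ('s, 'd, 'm) dterm \<Rightarrow> ('s, 'd, 'm) dterm" where
  "dsubst \<rho> (DCon d) = DCon d"
| "dsubst \<rho> (DFlx v) = \<rho> v"
| "dsubst \<rho> (DApp f e) = DApp f (dsubst \<rho> e)"

fun bsubst :: "('s, 'd, 'm) valuation \<Rightarrow> ('s, 'd, 'm) bterm \<Rightarrow> ('s, 'd, 'm) bterm" where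
  "bsubst \<rho> B0 = B0"
| "bsubst \<rho> B1 = B1"
| "bsubst \<rho> (BApp p e) = BApp p (dsubst \<rho> e)"

fun csubst :: "('s, 'd, 'm) valuation \<Rightarrow> ('s, 'd, 'm) cond \<Rightarrow> ('s, 'd, 'm) cond" where
  "csubst \<rho> (CEqD e e') = CEqD (dsubst \<rho> e) (dsubst \<rho> e')"
| "csubst \<rho> (CEqB b b') = CEqB (bsubst \<rho> b) (bsubst \<rho> b')"
| "csubst \<rho> CTrue = CTrue"
| "csubst \<rho> CFalse = CFalse"
| "csubst \<rho> (CNot \<phi>) = CNot (csubst \<rho> \<phi>)"
| "csubst \<rho> (CAnd \<phi> \<psi>) = CAnd (csubst \<rho> \<phi>) (csubst \<rho> \<psi>)"
| "csubst \<rho> (COr \<phi> \<psi>) = COr (csubst \<rho> \<phi>) (csubst \<rho> \<psi>)"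
| "csubst \<rho> (CImp \<phi> \<psi>) = CImp (csubst \<rho> \<phi>) (csubst \<rho> \<psi>)"


section \<open>Process terms\<close>

text \<open>
  Linear terms and the recursive specifications built from them contain no recursion
  constants, so they precede the general process terms.
\<close>

datatype ('s, 'd, 'm, 'a) atom = AAct 'a | AAsg 'm "('s, 'd, 'm) dterm"

datatype ('s, 'd, 'm, 'a, 'x) lin =
    LDelta
  | LEps "('s, 'd, 'm) cond"
  | LPre "('s, 'd, 'm) cond" "('s, 'd, 'm, 'a) atom" 'x
  | LAlt "('s, 'd, 'm, 'a, 'x) lin" "('s, 'd, 'm, 'a, 'x) lin"

type_synonym ('s, 'd, 'm, 'a, 'x) rspec = "('x \<times> ('s, 'd, 'm, 'a, 'x) lin) set"

datatype ('s, 'd, 'm, 'a, 'x) pterm =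
    PAct 'a
  | PDelta  ("\<delta>")
  | PEps  ("\<epsilon>")
  | PAlt "('s, 'd, 'm, 'a, 'x) pterm" "('s, 'd, 'm, 'a, 'x) pterm"  (infixl "\<oplus>" 65)
  | PSeq "('s, 'd, 'm, 'a, 'x) pterm" "('s, 'd, 'm, 'a, 'x) pterm"  (infixl "\<odot>" 75)
  | PAsg 'm "('s, 'd, 'm) dterm"
  | PGrd "('s, 'd, 'm) cond" "('s, 'd, 'm, 'a, 'x) pterm"  (infixr "\<triangleright>" 70)
  | PEval "('s, 'd, 'm) valuation" "('s, 'd, 'm, 'a, 'x) pterm"
  | PRec 'x "('s, 'd, 'm, 'a, 'x) rspec"

fun wf_atom :: "'s alphabet \<Rightarrow> ('s, 'd) interp \<Rightarrow> 'a set \<Rightarrow> ('s, 'd, 'm, 'a) atom \<Rightarrow> bool" where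
  "wf_atom sg I Act (AAct a) \<longleftrightarrow> a \<in> Act"
| "wf_atom sg I Act (AAsg v e) \<longleftrightarrow> wf_dterm sg I e"

fun wf_lin :: "'s alphabet \<Rightarrow> ('s, 'd) interp \<Rightarrow> 'a set \<Rightarrow> ('s, 'd, 'm, 'a, 'x) lin \<Rightarrow> bool" where
  "wf_lin sg I Act LDelta \<longleftrightarrow> True"
| "wf_lin sg I Act (LEps \<phi>) \<longleftrightarrow> wf_cond sg I \<phi>"
| "wf_lin sg I Act (LPre \<phi> \<alpha> X) \<longleftrightarrow> wf_cond sg I \<phi> \<and> wf_atom sg I Act \<alpha>"
| "wf_lin sg I Act (LAlt t t') \<longleftrightarrow>
     t \<noteq> LDelta \<and> t' \<noteq> LDelta \<and> wf_lin sg I Act t \<and> wf_lin sg I Act t'"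

fun lin_vars :: "('s, 'd, 'm, 'a, 'x) lin \<Rightarrow> 'x set" where
  "lin_vars LDelta = {}"
| "lin_vars (LEps \<phi>) = {}"
| "lin_vars (LPre \<phi> \<alpha> X) = {X}"
| "lin_vars (LAlt t t') = lin_vars t \<union> lin_vars t'"

definition rvars :: "('s, 'd, 'm, 'a, 'x) rspec \<Rightarrow> 'x set" where
  "rvars S = fst ` S"

definition lin_rec_spec ::
  "'s alphabet \<Rightarrow> ('s, 'd) interp \<Rightarrow> 'a set \<Rightarrow> ('s, 'd, 'm, 'a, 'x) rspec \<Rightarrow> bool"
where
  "lin_rec_spec sg I Act S \<longleftrightarrow> single_valued S \<and>
     (\<forall>(X, t)\<in>S. wf_lin sg I Act t \<and> lin_vars t \<subseteq> rvars S)"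

fun wf_pterm :: "'s alphabet \<Rightarrow> ('s, 'd) interp \<Rightarrow> 'a set \<Rightarrow> ('s, 'd, 'm, 'a, 'x) pterm \<Rightarrow> bool" where
  "wf_pterm sg I Act (PAct a) \<longleftrightarrow> a \<in> Act"
| "wf_pterm sg I Act \<delta> \<longleftrightarrow> True"
| "wf_pterm sg I Act \<epsilon> \<longleftrightarrow> True"
| "wf_pterm sg I Act (t \<oplus> t') \<longleftrightarrow> wf_pterm sg I Act t \<and> wf_pterm sg I Act t'"
| "wf_pterm sg I Act (t \<odot> t') \<longleftrightarrow> wf_pterm sg I Act t \<and> wf_pterm sg I Act t'"
| "wf_pterm sg I Act (PAsg v e) \<longleftrightarrow> wf_dterm sg I e"
| "wf_pterm sg I Act (\<phi> \<triangleright> t) \<longleftrightarrow> wf_cond sg I \<phi> \<and> wf_pterm sg I Act t"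
| "wf_pterm sg I Act (PEval \<rho> t) \<longleftrightarrow> wf_valuation sg I \<rho> \<and> wf_pterm sg I Act t"
| "wf_pterm sg I Act (PRec X S) \<longleftrightarrow> lin_rec_spec sg I Act S \<and> X \<in> rvars S"

fun atom_term :: "('s, 'd, 'm, 'a) atom \<Rightarrow> ('s, 'd, 'm, 'a, 'x) pterm" where
  "atom_term (AAct a) = PAct a"
| "atom_term (AAsg v e) = PAsg v e"

text \<open>The process term obtained from a linear term by substituting \<open>\<sigma> X\<close> for each variable \<open>X\<close>.\<close>

fun lin_inst ::
  "('x \<Rightarrow> ('s, 'd, 'm, 'a, 'x) pterm) \<Rightarrow> ('s, 'd, 'm, 'a, 'x) lin \<Rightarrow> ('s, 'd, 'm, 'a, 'x) pterm"
where
  "lin_inst \<sigma> LDelta = \<delta>"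
| "lin_inst \<sigma> (LEps \<phi>) = \<phi> \<triangleright> \<epsilon>"
| "lin_inst \<sigma> (LPre \<phi> \<alpha> X) = \<phi> \<triangleright> (atom_term \<alpha> \<odot> \<sigma> X)"
| "lin_inst \<sigma> (LAlt t t') = lin_inst \<sigma> t \<oplus> lin_inst \<sigma> t'"


section \<open>Derivability\<close>

inductive bpa_axiom :: "('s, 'd, 'm, 'a, 'x) pterm \<Rightarrow> ('s, 'd, 'm, 'a, 'x) pterm \<Rightarrow> bool" where
  A1: "bpa_axiom (x \<oplus> y) (y \<oplus> x)"
| A2: "bpa_axiom ((x \<oplus> y) \<oplus> z) (x \<oplus> (y \<oplus> z))"
| A3: "bpa_axiom (x \<oplus> x) x"
| A4: "bpa_axiom ((x \<oplus> y) \<odot> z) (x \<odot> z \<oplus> y \<odot> z)"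
| A5: "bpa_axiom ((x \<odot> y) \<odot> z) (x \<odot> (y \<odot> z))"
| A6: "bpa_axiom (x \<oplus> \<delta>) x"
| A7: "bpa_axiom (\<delta> \<odot> x) \<delta>"
| A8: "bpa_axiom (x \<odot> \<epsilon>) x"
| A9: "bpa_axiom (\<epsilon> \<odot> x) x"
| GC1: "bpa_axiom (CTrue \<triangleright> x) x"
| GC2: "bpa_axiom (CFalse \<triangleright> x) \<delta>"
| GC3: "bpa_axiom (\<phi> \<triangleright> \<delta>) \<delta>"
| GC4: "bpa_axiom (\<phi> \<triangleright> (x \<oplus> y)) ((\<phi> \<triangleright> x) \<oplus> (\<phi> \<triangleright> y))"
| GC5: "bpa_axiom (\<phi> \<triangleright> (x \<odot> y)) ((\<phi> \<triangleright> x) \<odot> y)"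
| GC6: "bpa_axiom (\<phi> \<triangleright> (\<psi> \<triangleright> x)) (CAnd \<phi> \<psi> \<triangleright> x)"
| GC7: "bpa_axiom (COr \<phi> \<psi> \<triangleright> x) ((\<phi> \<triangleright> x) \<oplus> (\<psi> \<triangleright> x))"
| V1: "bpa_axiom (PEval \<rho> \<epsilon>) \<epsilon>"
| V2: "bpa_axiom (PEval \<rho> (PAct a \<odot> x)) (PAct a \<odot> PEval \<rho> x)"
| V3: "bpa_axiom (PEval \<rho> (PAsg v e \<odot> x))
         (PAsg v (dsubst \<rho> e) \<odot> PEval (\<rho>(v := dsubst \<rho> e)) x)"
| V4: "bpa_axiom (PEval \<rho> (x \<oplus> y)) (PEval \<rho> x \<oplus> PEval \<rho> y)"
| V5: "bpa_axiom (PEval \<rho> (\<phi> \<triangleright> x)) (csubst \<rho> \<phi> \<triangleright> PEval \<rho> x)"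
| RDP: "(X, t) \<in> S \<Longrightarrow> bpa_axiom (PRec X S) (lin_inst (\<lambda>Y. PRec Y S) t)"

text \<open>
  Equational logic over the four sorts. The terms are variable-free and the axioms are used
  through all their well-formed instances; hence no substitution rule is needed. The
  valuation \<open>\<rho>\<close> is an index of the evaluation operator, not an argument, so there is no
  congruence in \<open>\<rho>\<close>.
\<close>

inductive deq ::
  "'s alphabet \<Rightarrow> ('s, 'd) interp \<Rightarrow> ('s, 'd) dalg \<Rightarrow>
   ('s, 'd, 'm) dterm \<Rightarrow> ('s, 'd, 'm) dterm \<Rightarrow> bool"
  for sg I \<DD>
where
  IMP1: "wf_dterm sg I e \<Longrightarrow> wf_dterm sg I e' \<Longrightarrow> dvalid \<DD> (CEqD e e') \<Longrightarrow> deq sg I \<DD> e e'"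
| refl: "wf_dterm sg I e \<Longrightarrow> deq sg I \<DD> e e"
| sym: "deq sg I \<DD> e e' \<Longrightarrow> deq sg I \<DD> e' e"
| trans: "deq sg I \<DD> e e' \<Longrightarrow> deq sg I \<DD> e' e'' \<Longrightarrow> deq sg I \<DD> e e''"
| cong_App: "f \<in> funs sg \<Longrightarrow> deq sg I \<DD> e e' \<Longrightarrow> deq sg I \<DD> (DApp f e) (DApp f e')"

inductive beq ::
  "'s alphabet \<Rightarrow> ('s, 'd) interp \<Rightarrow> ('s, 'd) dalg \<Rightarrow>
   ('s, 'd, 'm) bterm \<Rightarrow> ('s, 'd, 'm) bterm \<Rightarrow> bool"
  for sg I \<DD>
where
  IMP1: "wf_bterm sg I b \<Longrightarrow> wf_bterm sg I b' \<Longrightarrow> dvalid \<DD> (CEqB b b') \<Longrightarrow> beq sg I \<DD> b b'"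
| refl: "wf_bterm sg I b \<Longrightarrow> beq sg I \<DD> b b"
| sym: "beq sg I \<DD> b b' \<Longrightarrow> beq sg I \<DD> b' b"
| trans: "beq sg I \<DD> b b' \<Longrightarrow> beq sg I \<DD> b' b'' \<Longrightarrow> beq sg I \<DD> b b''"
| cong_App: "p \<in> preds sg \<Longrightarrow> deq sg I \<DD> e e' \<Longrightarrow> beq sg I \<DD> (BApp p e) (BApp p e')"

inductive ceq ::
  "'s alphabet \<Rightarrow> ('s, 'd) interp \<Rightarrow> ('s, 'd) dalg \<Rightarrow>
   ('s, 'd, 'm) cond \<Rightarrow> ('s, 'd, 'm) cond \<Rightarrow> bool"
  for sg I \<DD>
where
  IMP2: "wf_cond sg I \<phi> \<Longrightarrow> wf_cond sg I \<psi> \<Longrightarrow> dvalid \<DD> (CAnd (CImp \<phi> \<psi>) (CImp \<psi> \<phi>)) \<Longrightarrow>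
    ceq sg I \<DD> \<phi> \<psi>"
| refl: "wf_cond sg I \<phi> \<Longrightarrow> ceq sg I \<DD> \<phi> \<phi>"
| sym: "ceq sg I \<DD> \<phi> \<psi> \<Longrightarrow> ceq sg I \<DD> \<psi> \<phi>"
| trans: "ceq sg I \<DD> \<phi> \<psi> \<Longrightarrow> ceq sg I \<DD> \<psi> \<chi> \<Longrightarrow> ceq sg I \<DD> \<phi> \<chi>"
| cong_EqD: "deq sg I \<DD> e1 e1' \<Longrightarrow> deq sg I \<DD> e2 e2' \<Longrightarrow> ceq sg I \<DD> (CEqD e1 e2) (CEqD e1' e2')"
| cong_EqB: "beq sg I \<DD> b1 b1' \<Longrightarrow> beq sg I \<DD> b2 b2' \<Longrightarrow> ceq sg I \<DD> (CEqB b1 b2) (CEqB b1' b2')"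
| cong_Not: "ceq sg I \<DD> \<phi> \<phi>' \<Longrightarrow> ceq sg I \<DD> (CNot \<phi>) (CNot \<phi>')"
| cong_And: "ceq sg I \<DD> \<phi> \<phi>' \<Longrightarrow> ceq sg I \<DD> \<psi> \<psi>' \<Longrightarrow> ceq sg I \<DD> (CAnd \<phi> \<psi>) (CAnd \<phi>' \<psi>')"
| cong_Or: "ceq sg I \<DD> \<phi> \<phi>' \<Longrightarrow> ceq sg I \<DD> \<psi> \<psi>' \<Longrightarrow> ceq sg I \<DD> (COr \<phi> \<psi>) (COr \<phi>' \<psi>')"
| cong_Imp: "ceq sg I \<DD> \<phi> \<phi>' \<Longrightarrow> ceq sg I \<DD> \<psi> \<psi>' \<Longrightarrow> ceq sg I \<DD> (CImp \<phi> \<psi>) (CImp \<phi>' \<psi>')"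

inductive derivable ::
  "'s alphabet \<Rightarrow> ('s, 'd) interp \<Rightarrow> ('s, 'd) dalg \<Rightarrow> 'a set \<Rightarrow>
   ('s, 'd, 'm, 'a, 'x) pterm \<Rightarrow> ('s, 'd, 'm, 'a, 'x) pterm \<Rightarrow> bool"
  for sg I \<DD> Act
where
  ax: "bpa_axiom t t' \<Longrightarrow> wf_pterm sg I Act t \<Longrightarrow> wf_pterm sg I Act t' \<Longrightarrow>
    derivable sg I \<DD> Act t t'"
| RSP: "lin_rec_spec sg I Act S \<Longrightarrow>
    \<forall>(Y, u)\<in>S. derivable sg I \<DD> Act (\<sigma> Y) (lin_inst \<sigma> u) \<Longrightarrow>
    X \<in> rvars S \<Longrightarrow> derivable sg I \<DD> Act (\<sigma> X) (PRec X S)"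
| refl: "wf_pterm sg I Act t \<Longrightarrow> derivable sg I \<DD> Act t t"
| sym: "derivable sg I \<DD> Act t t' \<Longrightarrow> derivable sg I \<DD> Act t' t"
| trans: "derivable sg I \<DD> Act t t' \<Longrightarrow> derivable sg I \<DD> Act t' t'' \<Longrightarrow> derivable sg I \<DD> Act t t''"
| cong_Alt: "derivable sg I \<DD> Act t t' \<Longrightarrow> derivable sg I \<DD> Act u u' \<Longrightarrow>
    derivable sg I \<DD> Act (t \<oplus> u) (t' \<oplus> u')"
| cong_Seq: "derivable sg I \<DD> Act t t' \<Longrightarrow> derivable sg I \<DD> Act u u' \<Longrightarrow>
    derivable sg I \<DD> Act (t \<odot> u) (t' \<odot> u')"
| cong_Asg: "deq sg I \<DD> e e' \<Longrightarrow> derivable sg I \<DD> Act (PAsg v e) (PAsg v e')"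
| cong_Grd: "ceq sg I \<DD> \<phi> \<phi>' \<Longrightarrow> derivable sg I \<DD> Act t t' \<Longrightarrow>
    derivable sg I \<DD> Act (\<phi> \<triangleright> t) (\<phi>' \<triangleright> t')"
| cong_Eval: "wf_valuation sg I \<rho> \<Longrightarrow> derivable sg I \<DD> Act t t' \<Longrightarrow>
    derivable sg I \<DD> Act (PEval \<rho> t) (PEval \<rho> t')"


section \<open>From algorithm graphs to processes\<close>

text \<open>
  The recursion variables \<open>X\<close>, \<open>X\<^sub>v\<close> and \<open>X\<^sub>\<epsilon>\<close> chosen for a graph are explicit parameters
  \<open>x\<close>, \<open>xv\<close> and \<open>xe\<close>.
\<close>

definition fresh_names :: "('s, 'v) agraph \<Rightarrow> 'x \<Rightarrow> ('v \<Rightarrow> 'x) \<Rightarrow> 'x \<Rightarrow> bool" where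
  "fresh_names G x xv xe \<longleftrightarrow>
     inj_on xv (verts G) \<and> x \<notin> xv ` verts G \<and> xe \<notin> xv ` verts G \<and> x \<noteq> xe"

definition gr2pr_spec ::
  "'s alphabet \<Rightarrow> 'm \<Rightarrow> 'x \<Rightarrow> ('v \<Rightarrow> 'x) \<Rightarrow> 'x \<Rightarrow> ('s, 'v) agraph \<Rightarrow> ('s, 'd, 'm, 'a, 'x) rspec"
where
  "gr2pr_spec sg MEM x xv xe G =
     {(x, LPre CTrue (AAsg MEM (DApp (ini sg) (DFlx MEM))) (xv v')) |v'. (root G, v') \<in> edges G} \<union>
     {(xv v, LPre CTrue (AAsg MEM (DApp f (DFlx MEM))) (xv v')) |v f v'.
        v \<in> verts G \<and> f \<in> inner_funs sg \<and> vlab G v = Some f \<and> (v, v') \<in> edges G} \<union>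
     {(xv v, LAlt (LPre (CEqB (BApp p (DFlx MEM)) B1) (AAsg MEM (DFlx MEM)) (xv v'))
                  (LPre (CEqB (BApp p (DFlx MEM)) B0) (AAsg MEM (DFlx MEM)) (xv v''))) |v p v' v''.
        v \<in> verts G \<and> p \<in> preds sg \<and> vlab G v = Some p \<and>
        (v, v') \<in> edges G \<and> elab G (v, v') = Some True \<and>
        (v, v'') \<in> edges G \<and> elab G (v, v'') = Some False} \<union>
     {(xv v, LPre CTrue (AAsg MEM (DApp (fin sg) (DFlx MEM))) xe) |v.
        v \<in> verts G \<and> vlab G v = Some (fin sg)} \<union>
     {(xe, LEps CTrue)}"

definition gr2pr ::
  "'s alphabet \<Rightarrow> 'm \<Rightarrow> 'x \<Rightarrow> ('v \<Rightarrow> 'x) \<Rightarrow> 'x \<Rightarrow> ('s, 'v) agraph \<Rightarrow> ('s, 'd, 'm, 'a, 'x) pterm"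
where
  "gr2pr sg MEM x xv xe G = PRec x (gr2pr_spec sg MEM x xv xe G)"

end

theory Submission
  imports Defs
begin

text \<open>
  Derivable equality is sound for a trace model. A process denotes, for each environment \<open>\<eta>\<close>
  giving values to the flexible variables, the set of its finite traces together with the
  information which of them end in successful termination; a trace records the basic actions
  and the values assigned, and the assignments performed determine the environment in which
  the rest of the process is evaluated. Linear specifications are guarded, so their solutions
  in this model are unique (by induction on the length of traces), which validates RSP.
  The process of an algorithm graph is deterministic: its traces are the prefixes of a single
  run, recording the data value after each algorithmic step. Hence relating internal states
  that carry the same data value and whose processes have the same traces is an algorithmic
  simulation.
\<close>

section \<open>Traces\<close>

datatype ('d, 'm, 'a) label = Basic 'a | Write 'm 'd

fun upd :: "('m \<Rightarrow> 'd) \<Rightarrow> ('d, 'm, 'a) label \<Rightarrow> ('m \<Rightarrow> 'd)" where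
  "upd \<eta> (Basic a) = \<eta>"
| "upd \<eta> (Write v d) = \<eta>(v := d)"

abbreviation upds :: "('m \<Rightarrow> 'd) \<Rightarrow> ('d, 'm, 'a) label list \<Rightarrow> ('m \<Rightarrow> 'd)" where
  "upds \<equiv> foldl upd"

fun atom_label ::
  "('s, 'd) dalg \<Rightarrow> ('m \<Rightarrow> 'd) \<Rightarrow> ('s, 'd, 'm, 'a) atom \<Rightarrow> ('d, 'm, 'a) label" where
  "atom_label \<DD> \<eta> (AAct a) = Basic a"
| "atom_label \<DD> \<eta> (AAsg v e) = Write v (deval \<DD> \<eta> e)"

text \<open>Together with \<open>lin_steps\<close> this is the one-step operational semantics of
  linear terms. It lets \<open>rec_trace\<close> recurse on the trace alone, so that recursion
  constants get a meaning although unfolding them need not terminate.\<close>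

fun lin_accepts :: "('s, 'd) dalg \<Rightarrow> ('m \<Rightarrow> 'd) \<Rightarrow> ('s, 'd, 'm, 'a, 'x) lin \<Rightarrow> bool" where
  "lin_accepts \<DD> \<eta> LDelta \<longleftrightarrow> False"
| "lin_accepts \<DD> \<eta> (LEps \<phi>) \<longleftrightarrow> ceval \<DD> \<eta> \<phi>"
| "lin_accepts \<DD> \<eta> (LPre \<phi> \<alpha> X) \<longleftrightarrow> False"
| "lin_accepts \<DD> \<eta> (LAlt t t') \<longleftrightarrow> lin_accepts \<DD> \<eta> t \<or> lin_accepts \<DD> \<eta> t'"

fun lin_steps ::
  "('s, 'd) dalg \<Rightarrow> ('m \<Rightarrow> 'd) \<Rightarrow> ('s, 'd, 'm, 'a, 'x) lin \<Rightarrow> (('d, 'm, 'a) label \<times> 'x) set" where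
  "lin_steps \<DD> \<eta> LDelta = {}"
| "lin_steps \<DD> \<eta> (LEps \<phi>) = {}"
| "lin_steps \<DD> \<eta> (LPre \<phi> \<alpha> X) = (if ceval \<DD> \<eta> \<phi> then {(atom_label \<DD> \<eta> \<alpha>, X)} else {})"
| "lin_steps \<DD> \<eta> (LAlt t t') = lin_steps \<DD> \<eta> t \<union> lin_steps \<DD> \<eta> t'"

text \<open>The Boolean argument of the following two predicates tells whether the trace is completed.\<close>

fun rec_trace ::
  "('s, 'd) dalg \<Rightarrow> ('s, 'd, 'm, 'a, 'x) rspec \<Rightarrow> 'x \<Rightarrow> ('m \<Rightarrow> 'd) \<Rightarrow>
   ('d, 'm, 'a) label list \<Rightarrow> bool \<Rightarrow> bool" where
  "rec_trace \<DD> S X \<eta> [] b \<longleftrightarrow> \<not> b \<or> (\<exists>u. (X, u) \<in> S \<and> lin_accepts \<DD> \<eta> u)"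
| "rec_trace \<DD> S X \<eta> (l # w) b \<longleftrightarrow>
     (\<exists>u Y. (X, u) \<in> S \<and> (l, Y) \<in> lin_steps \<DD> \<eta> u \<and> rec_trace \<DD> S Y (upd \<eta> l) w b)"

fun trace ::
  "('s, 'd) dalg \<Rightarrow> ('s, 'd, 'm, 'a, 'x) pterm \<Rightarrow> ('m \<Rightarrow> 'd) \<Rightarrow>
   ('d, 'm, 'a) label list \<Rightarrow> bool \<Rightarrow> bool" where
  "trace \<DD> (PAct a) \<eta> w b \<longleftrightarrow> w = [] \<and> \<not> b \<or> w = [Basic a]"
| "trace \<DD> \<delta> \<eta> w b \<longleftrightarrow> w = [] \<and> \<not> b"
| "trace \<DD> \<epsilon> \<eta> w b \<longleftrightarrow> w = []"
| "trace \<DD> (t \<oplus> t') \<eta> w b \<longleftrightarrow> trace \<DD> t \<eta> w b \<or> trace \<DD> t' \<eta> w b"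
| "trace \<DD> (t \<odot> t') \<eta> w b \<longleftrightarrow> \<not> b \<and> trace \<DD> t \<eta> w False \<or>
     (\<exists>u u'. w = u @ u' \<and> trace \<DD> t \<eta> u True \<and> trace \<DD> t' (upds \<eta> u) u' b)"
| "trace \<DD> (PAsg v e) \<eta> w b \<longleftrightarrow> w = [] \<and> \<not> b \<or> w = [Write v (deval \<DD> \<eta> e)]"
| "trace \<DD> (\<phi> \<triangleright> t) \<eta> w b \<longleftrightarrow> (if ceval \<DD> \<eta> \<phi> then trace \<DD> t \<eta> w b else w = [] \<and> \<not> b)"
| "trace \<DD> (PEval \<rho> t) \<eta> w b \<longleftrightarrow> trace \<DD> t (\<lambda>v. deval \<DD> \<eta> (\<rho> v)) w b"
| "trace \<DD> (PRec X S) \<eta> w b \<longleftrightarrow> rec_trace \<DD> S X \<eta> w b"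

lemma rec_trace_incomplete: "rec_trace \<DD> S X \<eta> w b \<Longrightarrow> rec_trace \<DD> S X \<eta> w False"
  by (induction w arbitrary: X \<eta>) auto

lemma trace_Nil_incomplete [simp]: "trace \<DD> t \<eta> [] False"
  by (induction t arbitrary: \<eta>) auto

text \<open>Needed for axiom A8: the incomplete traces of \<open>x \<odot> \<epsilon>\<close>
  include the completed traces of \<open>x\<close>, so these have to count as incomplete traces of
  \<open>x\<close> as well.\<close>

lemma trace_incomplete: "trace \<DD> t \<eta> w b \<Longrightarrow> trace \<DD> t \<eta> w False"
proof (induction t arbitrary: \<eta> w b)
  case (PSeq t1 t2)
  then show ?case by (auto; blast)
qed (auto split: if_splits intro: rec_trace_incomplete)

lemma trace_atom_term:
  "trace \<DD> (atom_term \<alpha>) \<eta> w b \<longleftrightarrow> w = [] \<and> \<not> b \<or> w = [atom_label \<DD> \<eta> \<alpha>]"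
  by (cases \<alpha>) auto

lemma trace_lin_inst_Nil:
  "trace \<DD> (lin_inst \<sigma> u) \<eta> [] b \<longleftrightarrow> \<not> b \<or> lin_accepts \<DD> \<eta> u"
  by (induction u) (auto simp: trace_atom_term)

text \<open>This is guardedness: in every summand with a variable an atom precedes it, so the first
  label comes from the linear term itself and the substituted term only contributes the strictly
  shorter rest. The recursion has the same form as that of \<open>rec_trace\<close>.\<close>

lemma trace_lin_inst_Cons:
  "trace \<DD> (lin_inst \<sigma> u) \<eta> (l # w) b \<longleftrightarrow>
     (\<exists>Y. (l, Y) \<in> lin_steps \<DD> \<eta> u \<and> trace \<DD> (\<sigma> Y) (upd \<eta> l) w b)"
  by (induction u) (auto simp: trace_atom_term)


section \<open>Evaluation of terms\<close>

lemma deval_dsubst: "deval \<DD> \<eta> (dsubst \<rho> e) = deval \<DD> (\<lambda>v. deval \<DD> \<eta> (\<rho> v)) e"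
  by (induction e) auto

lemma beval_bsubst: "beval \<DD> \<eta> (bsubst \<rho> b) = beval \<DD> (\<lambda>v. deval \<DD> \<eta> (\<rho> v)) b"
  by (cases b) (auto simp: deval_dsubst)

lemma ceval_csubst: "ceval \<DD> \<eta> (csubst \<rho> \<phi>) = ceval \<DD> (\<lambda>v. deval \<DD> \<eta> (\<rho> v)) \<phi>"
  by (induction \<phi>) (auto simp: deval_dsubst beval_bsubst)

lemma deval_closed: "closed_dterm e \<Longrightarrow> deval \<DD> \<eta> e = deval \<DD> \<eta>' e"
  by (induction e) auto

lemma closed_dsubst: "(\<And>v. closed_dterm (\<rho> v)) \<Longrightarrow> closed_dterm (dsubst \<rho> e)"
  by (induction e) auto

text \<open>Validity in the data algebra quantifies only over values in the carrier, so IMP1 and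
  IMP2 are sound only for such environments. The next lemmas show that runs of well-formed terms
  never leave them.\<close>

definition env_in :: "'d set \<Rightarrow> ('m \<Rightarrow> 'd) \<Rightarrow> bool" where
  "env_in C \<eta> \<longleftrightarrow> range \<eta> \<subseteq> C"

lemma data_algebraD:
  assumes "data_algebra sg I \<DD>"
  shows "dcarrier \<DD> = Dmain I \<union> Din I \<union> Dout I"
    and "\<forall>f\<in>funs sg. dfun \<DD> f ` dcarrier \<DD> \<subseteq> dcarrier \<DD>"
    and "\<forall>d\<in>Din I. dfun \<DD> (ini sg) d = ifun I (ini sg) d"
    and "\<forall>d\<in>Dmain I. dfun \<DD> (fin sg) d = ifun I (fin sg) d"
    and "\<forall>f\<in>inner_funs sg. \<forall>d\<in>Dmain I. dfun \<DD> f d = ifun I f d"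
    and "\<forall>p\<in>preds sg. \<forall>d\<in>Dmain I. dpred \<DD> p d = ipred I p d"
    and "\<not> (\<exists>C. C \<subset> dcarrier \<DD> \<and> Din I \<subseteq> C \<and> (\<forall>f\<in>funs sg. dfun \<DD> f ` C \<subseteq> C))"
  by (insert assms, unfold data_algebra_def) (elim conjE, assumption)+

lemma deval_in_carrier:
  assumes "data_algebra sg I \<DD>" "env_in (dcarrier \<DD>) \<eta>" "wf_dterm sg I e"
  shows "deval \<DD> \<eta> e \<in> dcarrier \<DD>"
  using assms(3)
proof (induction e)
  case (DCon d)
  then show ?case using data_algebraD(1)[OF assms(1)] by simp
next
  case (DApp f e)
  then show ?case using data_algebraD(2)[OF assms(1)] by auto
qed (use assms(2) in \<open>auto simp: env_in_def\<close>)

fun label_in :: "'d set \<Rightarrow> ('d, 'm, 'a) label \<Rightarrow> bool" where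
  "label_in C (Basic a) \<longleftrightarrow> True"
| "label_in C (Write v d) \<longleftrightarrow> d \<in> C"

lemma upd_in: "env_in C \<eta> \<Longrightarrow> label_in C l \<Longrightarrow> env_in C (upd \<eta> l)"
  by (cases l) (auto simp: env_in_def)

lemma upds_in: "env_in C \<eta> \<Longrightarrow> list_all (label_in C) w \<Longrightarrow> env_in C (upds \<eta> w)"
  by (induction w arbitrary: \<eta>) (simp_all add: upd_in)

lemma lin_steps_label_in:
  assumes "data_algebra sg I \<DD>" "env_in (dcarrier \<DD>) \<eta>"
    and "wf_lin sg I Act u" "(l, Y) \<in> lin_steps \<DD> \<eta> u"
  shows "label_in (dcarrier \<DD>) l"
  using assms(3,4)
proof (induction u)
  case (LPre \<phi> \<alpha> X)
  then show ?case using deval_in_carrier[OF assms(1,2)] by (cases \<alpha>) (auto split: if_splits)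
qed auto

lemma lin_steps_var: "(l, Y) \<in> lin_steps \<DD> \<eta> u \<Longrightarrow> Y \<in> lin_vars u"
  by (induction u) (auto split: if_splits)

lemma rec_trace_labels_in:
  assumes "data_algebra sg I \<DD>" "lin_rec_spec sg I Act S"
  shows "env_in (dcarrier \<DD>) \<eta> \<Longrightarrow> rec_trace \<DD> S X \<eta> w b \<Longrightarrow> list_all (label_in (dcarrier \<DD>)) w"
proof (induction w arbitrary: \<eta> X)
  case (Cons l w)
  then obtain u Y where u: "(X, u) \<in> S" "(l, Y) \<in> lin_steps \<DD> \<eta> u"
    "rec_trace \<DD> S Y (upd \<eta> l) w b" by auto
  with assms(2) have "wf_lin sg I Act u" by (auto simp: lin_rec_spec_def)
  then have "label_in (dcarrier \<DD>) l"
    by (rule lin_steps_label_in[OF assms(1) Cons.prems(1) _ u(2)])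
  with Cons.IH[OF upd_in u(3)] Cons.prems(1) show ?case by simp
qed simp

lemma valuation_env_in:
  assumes "data_algebra sg I \<DD>" "env_in (dcarrier \<DD>) \<eta>" "wf_valuation sg I \<rho>"
  shows "env_in (dcarrier \<DD>) (\<lambda>v. deval \<DD> \<eta> (\<rho> v))"
  using assms(3) deval_in_carrier[OF assms(1,2)] by (auto simp: wf_valuation_def env_in_def)

text \<open>In \<open>t \<odot> t'\<close> the second process starts in the environment left by a
  completed trace of the first. That environment stays in the carrier because every value written
  does.\<close>

lemma trace_labels_in:
  assumes "data_algebra sg I \<DD>"
  shows "wf_pterm sg I Act t \<Longrightarrow> env_in (dcarrier \<DD>) \<eta> \<Longrightarrow> trace \<DD> t \<eta> w b \<Longrightarrow>
    list_all (label_in (dcarrier \<DD>)) w"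
proof (induction t arbitrary: \<eta> w b)
  case (PSeq t1 t2)
  then consider "trace \<DD> t1 \<eta> w False"
    | u u' where "w = u @ u'" "trace \<DD> t1 \<eta> u True" "trace \<DD> t2 (upds \<eta> u) u' b" by auto
  then show ?case
  proof cases
    case 1
    with PSeq show ?thesis by auto
  next
    case 2
    with PSeq have "list_all (label_in (dcarrier \<DD>)) u" by auto
    with 2 PSeq show ?thesis using upds_in[of "dcarrier \<DD>" \<eta> u] by auto
  qed
next
  case (PAsg v e)
  then show ?case using deval_in_carrier[OF assms, of \<eta> e] by auto
next
  case (PEval \<rho> t)
  then show ?case using valuation_env_in[OF assms, of \<eta> \<rho>] by auto
next
  case (PRec X S)
  then show ?case using rec_trace_labels_in[OF assms, of Act S \<eta> X w b] by auto
qed (auto split: if_splits)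


section \<open>Soundness of derivability\<close>

lemma deq_sound:
  assumes "deq sg I \<DD> e e'"
  shows "wf_dterm sg I e \<and> wf_dterm sg I e' \<and>
    (\<forall>\<eta>. env_in (dcarrier \<DD>) \<eta> \<longrightarrow> deval \<DD> \<eta> e = deval \<DD> \<eta> e')"
  using assms by (induction rule: deq.induct) (auto simp: dvalid_def env_in_def[symmetric])

lemma beq_sound:
  assumes "beq sg I \<DD> b b'"
  shows "wf_bterm sg I b \<and> wf_bterm sg I b' \<and>
    (\<forall>\<eta>. env_in (dcarrier \<DD>) \<eta> \<longrightarrow> beval \<DD> \<eta> b = beval \<DD> \<eta> b')"
  using assms by (induction rule: beq.induct) (auto simp: dvalid_def env_in_def[symmetric] dest: deq_sound)

lemma ceq_sound:
  assumes "ceq sg I \<DD> \<phi> \<psi>"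
  shows "wf_cond sg I \<phi> \<and> wf_cond sg I \<psi> \<and>
    (\<forall>\<eta>. env_in (dcarrier \<DD>) \<eta> \<longrightarrow> ceval \<DD> \<eta> \<phi> = ceval \<DD> \<eta> \<psi>)"
  using assms
proof (induction rule: ceq.induct)
  case (IMP2 \<phi> \<psi>)
  then show ?case by (auto simp: dvalid_def env_in_def[symmetric])
next
  case (cong_EqD e1 e1' e2 e2')
  then show ?case using deq_sound by (metis ceval.simps(1) wf_cond.simps(1))
next
  case (cong_EqB b1 b1' b2 b2')
  then show ?case using beq_sound by (metis ceval.simps(2) wf_cond.simps(2))
qed auto

lemma trace_Seq_assoc: "trace \<DD> ((x \<odot> y) \<odot> z) \<eta> w b \<longleftrightarrow> trace \<DD> (x \<odot> (y \<odot> z)) \<eta> w b"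
proof
  assume "trace \<DD> ((x \<odot> y) \<odot> z) \<eta> w b"
  then show "trace \<DD> (x \<odot> (y \<odot> z)) \<eta> w b"
    by (fastforce simp: append_assoc)
next
  assume "trace \<DD> (x \<odot> (y \<odot> z)) \<eta> w b"
  then show "trace \<DD> ((x \<odot> y) \<odot> z) \<eta> w b"
    by simp (metis append_assoc foldl_append)
qed

lemma bpa_axiom_sound:
  assumes "bpa_axiom t t'" "wf_pterm sg I Act t"
  shows "trace \<DD> t \<eta> w b \<longleftrightarrow> trace \<DD> t' \<eta> w b"
  using assms
proof (induction rule: bpa_axiom.induct)
  case (A5 x y z)
  show ?case by (rule trace_Seq_assoc)
next
  case (A8 x)
  then show ?case using trace_incomplete[of \<DD> x \<eta> w] by (cases b) auto
next
  case (V3 \<rho> v e x)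
  then have cl: "\<And>u. closed_dterm (\<rho> u)" by (auto simp: wf_valuation_def)
  \<comment> \<open>The left side evaluates \<open>x\<close> after updating the values of
    \<open>\<rho>\<close>, the right side after updating \<open>\<rho>\<close> and also writing
    \<open>v\<close> in the outer environment. The outer write has no effect because all terms in
    the updated valuation are closed.\<close>
  have env: "(\<lambda>u. deval \<DD> (\<eta>(v := d)) (if u = v then dsubst \<rho> e else \<rho> u)) =
      (\<lambda>u. deval \<DD> \<eta> (\<rho> u))(v := deval \<DD> \<eta> (dsubst \<rho> e))" for d
    using deval_closed[OF cl] deval_closed[OF closed_dsubst[OF cl]] by fastforce
  show ?case by (auto simp: deval_dsubst env)
next
  case (V2 \<rho> a x)
  show ?case by auto
next
  case (RDP X u S)
  \<comment> \<open>Well-formedness of the recursion constant makes \<open>S\<close> single-valued,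
    so the existential over equations in \<open>rec_trace\<close> picks just the right-hand side
    \<open>u\<close>.\<close>
  then have sv: "(X, u') \<in> S \<longleftrightarrow> u' = u" for u'
    by (auto simp: lin_rec_spec_def single_valued_def)
  show ?case by (cases w) (simp_all add: sv trace_lin_inst_Nil trace_lin_inst_Cons)
qed (auto simp: ceval_csubst)

text \<open>Serves two purposes: in the congruence case for \<open>\<odot>\<close> it bounds the
  values written, and in the final theorem it turns the assumed equation into the fact that both
  graph specifications are linear recursive specifications.\<close>

lemma derivable_wf:
  assumes "derivable sg I \<DD> Act t t'"
  shows "wf_pterm sg I Act t \<and> wf_pterm sg I Act t'"
  using assms
proof (induction rule: derivable.induct)
  case (RSP S \<sigma> X)
  then show ?case by (fastforce simp: rvars_def)
qed (auto dest: deq_sound ceq_sound)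

text \<open>The semantic content of RSP. Induction on the trace works because one unfolding of an
  equation consumes one label; variable and environment are generalized since both change with that
  label.\<close>

lemma rec_trace_unique:
  assumes "data_algebra sg I \<DD>" "lin_rec_spec sg I Act S"
    and sol: "\<And>Y u \<eta> w b. (Y, u) \<in> S \<Longrightarrow> env_in (dcarrier \<DD>) \<eta> \<Longrightarrow>
      trace \<DD> (\<sigma> Y) \<eta> w b \<longleftrightarrow> trace \<DD> (lin_inst \<sigma> u) \<eta> w b"
  shows "X \<in> rvars S \<Longrightarrow> env_in (dcarrier \<DD>) \<eta> \<Longrightarrow> trace \<DD> (\<sigma> X) \<eta> w b \<longleftrightarrow> rec_trace \<DD> S X \<eta> w b"
proof (induction w arbitrary: X \<eta>)
  have sv: "(X, u') \<in> S \<longleftrightarrow> u' = u" if "(X, u) \<in> S" for X u u'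
    using assms(2) that by (auto simp: lin_rec_spec_def single_valued_def)
  {
    case Nil
    then obtain u where u: "(X, u) \<in> S" by (auto simp: rvars_def)
    show ?case by (simp add: sol[OF u] Nil trace_lin_inst_Nil sv[OF u])
  next
    case (Cons l w)
    then obtain u where u: "(X, u) \<in> S" by (auto simp: rvars_def)
    then have wf: "wf_lin sg I Act u" "lin_vars u \<subseteq> rvars S"
      using assms(2) by (auto simp: lin_rec_spec_def)
    have "trace \<DD> (\<sigma> Y) (upd \<eta> l) w b \<longleftrightarrow> rec_trace \<DD> S Y (upd \<eta> l) w b"
      if "(l, Y) \<in> lin_steps \<DD> \<eta> u" for Y
    proof (rule Cons.IH)
      show "Y \<in> rvars S" using lin_steps_var[OF that] wf(2) by blast
      show "env_in (dcarrier \<DD>) (upd \<eta> l)"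
        by (intro upd_in Cons.prems(2) lin_steps_label_in[OF assms(1) Cons.prems(2) wf(1) that])
    qed
    then have "(\<exists>Y. (l, Y) \<in> lin_steps \<DD> \<eta> u \<and> trace \<DD> (\<sigma> Y) (upd \<eta> l) w b) \<longleftrightarrow>
        (\<exists>Y. (l, Y) \<in> lin_steps \<DD> \<eta> u \<and> rec_trace \<DD> S Y (upd \<eta> l) w b)"
      by blast
    then show ?case
      by (simp add: sol[OF u Cons.prems(2)] trace_lin_inst_Cons sv[OF u])
  }
qed

text \<open>The environment is arbitrary in the induction because \<open>PEval\<close> and
  \<open>\<odot>\<close> pass subterms to other environments; each time the new environment must be
  shown to stay in the carrier.\<close>

theorem derivable_sound:
  assumes "derivable sg I \<DD> Act t t'" "data_algebra sg I \<DD>" "env_in (dcarrier \<DD>) \<eta>"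
  shows "trace \<DD> t \<eta> w b \<longleftrightarrow> trace \<DD> t' \<eta> w b"
  using assms(1,3)
proof (induction arbitrary: \<eta> w b rule: derivable.induct)
  case (ax t t')
  show ?case by (rule bpa_axiom_sound[OF ax(1,2)])
next
  case (RSP S \<sigma> X)
  have "trace \<DD> (\<sigma> Y) \<eta> w b \<longleftrightarrow> trace \<DD> (lin_inst \<sigma> u) \<eta> w b"
    if "(Y, u) \<in> S" "env_in (dcarrier \<DD>) \<eta>" for Y u \<eta> w b
    using bspec[OF RSP(3) that(1)] that(2) by simp
  then show ?case
    using rec_trace_unique[OF assms(2) RSP(1) _ RSP(2,4)] by simp
next
  case (cong_Seq t t' u u')
  have "trace \<DD> u (upds \<eta> w1) w2 b \<longleftrightarrow> trace \<DD> u' (upds \<eta> w1) w2 b"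
    \<comment> \<open>Restricting to completed traces of \<open>t\<close> suffices for both
      directions, since the induction hypothesis gives \<open>t'\<close> the same completed traces
      in \<open>\<eta>\<close>.\<close>
    if "trace \<DD> t \<eta> w1 True" for w1 w2 b
  proof -
    have "list_all (label_in (dcarrier \<DD>)) w1"
      using trace_labels_in[OF assms(2) _ cong_Seq.prems that, where Act = Act] derivable_wf[OF cong_Seq.hyps(1)]
      by simp
    then show ?thesis by (intro cong_Seq.IH(2) upds_in[OF cong_Seq.prems])
  qed
  then show ?case using cong_Seq.IH(1)[OF cong_Seq.prems]
    by (simp cong: conj_cong)
next
  case (cong_Eval \<rho> t t')
  have "env_in (dcarrier \<DD>) (\<lambda>v. deval \<DD> \<eta> (\<rho> v))"
    by (rule valuation_env_in[OF assms(2) cong_Eval.prems cong_Eval.hyps(1)])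
  then show ?case unfolding trace.simps by (rule cong_Eval.IH)
next
  case (cong_Asg e e' v)
  have "deval \<DD> \<eta> e = deval \<DD> \<eta> e'" using deq_sound[OF cong_Asg(1)] cong_Asg(2) by blast
  then show ?case by simp
next
  case (cong_Grd \<phi> \<phi>' t t')
  have "ceval \<DD> \<eta> \<phi> = ceval \<DD> \<eta> \<phi>'"
    using ceq_sound[OF cong_Grd.hyps(1)] cong_Grd.prems by blast
  then show ?case using cong_Grd.IH[OF cong_Grd.prems] by simp
next
  case (trans t t' t'')
  show ?case using trans.IH[OF trans.prems] by simp
next
  case (cong_Alt t t' u u')
  show ?case using cong_Alt.IH[OF cong_Alt.prems] by simp
next
  case (sym t t')
  show ?case by (rule sym.IH[OF sym.prems, symmetric])
next
  case (refl t)
  show ?case by (rule HOL.refl)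
qed


section \<open>The process of an algorithm graph\<close>

fun state_var :: "'x \<Rightarrow> ('v \<Rightarrow> 'x) \<Rightarrow> 'x \<Rightarrow> ('v, 'd) state \<Rightarrow> 'x" where
  "state_var x xv xe (StIn d) = x"
| "state_var x xv xe (StMid v d) = xv v"
| "state_var x xv xe (StOut d) = xe"

fun state_data :: "('v, 'd) state \<Rightarrow> 'd" where
  "state_data (StIn d) = d"
| "state_data (StMid v d) = d"
| "state_data (StOut d) = d"

text \<open>The set \<open>V\<close> will be the vertices whose recursion variable has an equation.
  This excludes the root and the unlabeled vertices, where \<open>astep\<close> is undefined on
  internal states.\<close>

fun state_ok :: "('s, 'v) agraph \<Rightarrow> ('s, 'd) interp \<Rightarrow> 'v set \<Rightarrow> ('v, 'd) state \<Rightarrow> bool" where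
  "state_ok G I V (StIn d) \<longleftrightarrow> d \<in> Din I"
| "state_ok G I V (StMid v d) \<longleftrightarrow> v \<in> verts G \<and> v \<in> V \<and> d \<in> Dmain I"
| "state_ok G I V (StOut d) \<longleftrightarrow> d \<in> Dout I"

lemma outdeg_1_the:
  assumes "outdeg G v = 1" "(v, u) \<in> edges G"
  shows "(THE u. (v, u) \<in> edges G) = u"
proof -
  obtain a where "{u. (v, u) \<in> edges G} = {a}"
    using assms(1) by (auto simp: outdeg_def card_1_singleton_iff)
  then have "(v, u') \<in> edges G \<longleftrightarrow> u' = a" for u' by blast
  then show ?thesis using assms(2) by simp
qed

lemma outdeg_2_the:
  assumes "outdeg G v = 2" "(v, u) \<in> edges G" "elab G (v, u) = Some c"
    and "\<forall>u w. (v, u) \<in> edges G \<and> (v, w) \<in> edges G \<and> u \<noteq> w \<longrightarrow> elab G (v, u) \<noteq> elab G (v, w)"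
  shows "(THE u. (v, u) \<in> edges G \<and> elab G (v, u) = Some c) = u"
  using assms(2-4) by (intro the_equality) metis+

text \<open>
  That the specification is a linear recursive specification rules out unlabeled vertices
  reachable from the root: they have no equation.
\<close>

locale graph_process =
  fixes sg :: "'s alphabet" and G :: "('s, 'v) agraph" and I :: "('s, 'd) interp"
    and \<DD> :: "('s, 'd) dalg" and MEM :: 'm and x xe :: 'x and xv :: "'v \<Rightarrow> 'x"
    and S :: "('s, 'd, 'm, 'a, 'x) rspec" and Act :: "'a set"
  assumes S_def: "S = gr2pr_spec sg MEM x xv xe G"
    and alg: "proto_algorithm (sg, G, I)"
    and algebra: "data_algebra sg I \<DD>"
    and fresh: "fresh_names G x xv xe"
    and spec: "lin_rec_spec sg I Act S"
begin

abbreviation "ok \<equiv> state_ok G I {v. xv v \<in> rvars S}"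
abbreviation "var \<equiv> state_var x xv xe"

lemma sg: "alphabet sg" and graph: "algorithm_graph sg G" and interp: "interpretation_of sg I"
  using alg by (simp_all add: proto_algorithm_def)

lemma interp_closed:
  "ifun I (ini sg) ` Din I \<subseteq> Dmain I" "ifun I (fin sg) ` Dmain I \<subseteq> Dout I"
  "\<forall>f\<in>inner_funs sg. ifun I f ` Dmain I \<subseteq> Dmain I"
  by (insert interp, unfold interpretation_of_def) (elim conjE, assumption)+

lemma graph_vertex:
  assumes "v \<in> verts G"
  shows "v = root G \<Longrightarrow> outdeg G v = 1"
    and "f \<in> inner_funs sg \<Longrightarrow> vlab G v = Some f \<Longrightarrow> outdeg G v = 1"
    and "p \<in> preds sg \<Longrightarrow> vlab G v = Some p \<Longrightarrow> outdeg G v = 2 \<and>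
      (\<forall>u w. (v, u) \<in> edges G \<and> (v, w) \<in> edges G \<and> u \<noteq> w \<longrightarrow> elab G (v, u) \<noteq> elab G (v, w))"
  using graph assms by (simp_all add: algorithm_graph_def)

lemma disjoint_labels: "f \<in> inner_funs sg \<Longrightarrow> f \<notin> preds sg \<and> f \<noteq> fin sg"
    "fin sg \<notin> preds sg" "fin sg \<notin> inner_funs sg"
  using sg by (auto simp: alphabet_def inner_funs_def)

lemma edge_verts: "(v, u) \<in> edges G \<Longrightarrow> v \<in> verts G \<and> u \<in> verts G"
  using graph by (auto simp: algorithm_graph_def)

lemma equation_unique: "(X, u) \<in> S \<Longrightarrow> (X, u') \<in> S \<longleftrightarrow> u' = u"
  using spec by (auto simp: lin_rec_spec_def single_valued_def)

lemma lin_vars_rvars: "(X, u) \<in> S \<Longrightarrow> lin_vars u \<subseteq> rvars S"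
  using spec by (auto simp: lin_rec_spec_def)

lemma rec_trace_xe: "rec_trace \<DD> S xe \<eta> w b \<longleftrightarrow> w = []"
proof -
  have "(xe, LEps CTrue) \<in> S" by (auto simp: S_def gr2pr_spec_def)
  from equation_unique[OF this] show ?thesis by (cases w) auto
qed

lemma rec_trace_Cons:
  assumes "(X, u) \<in> S"
  shows "rec_trace \<DD> S X \<eta> (l # w) b \<longleftrightarrow>
    (\<exists>Y. (l, Y) \<in> lin_steps \<DD> \<eta> u \<and> rec_trace \<DD> S Y (upd \<eta> l) w b)"
  by (simp add: equation_unique[OF assms])

lemma rec_trace_single:
  assumes "(X, LPre CTrue (AAsg MEM e) Y) \<in> S"
  shows "rec_trace \<DD> S X \<eta> (l # w) b \<longleftrightarrow>
    l = Write MEM (deval \<DD> \<eta> e) \<and> rec_trace \<DD> S Y (\<eta>(MEM := deval \<DD> \<eta> e)) w b"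
  unfolding rec_trace_Cons[OF assms] by (simp cong: conj_cong)

text \<open>One algorithmic step corresponds to one trace label, which writes the data of the
  successor state to \<open>MEM\<close>. The successor vertex has an equation because right-hand
  sides of \<open>S\<close> mention only variables of \<open>S\<close>.\<close>

lemma step_in:
  assumes "d \<in> Din I" "\<eta> MEM = d"
  shows "\<exists>t. astep (sg, G, I) (StIn d) = Some t \<and> ok t \<and> t \<notin> range StIn \<and>
    (\<forall>l w b. rec_trace \<DD> S x \<eta> (l # w) b \<longleftrightarrow>
      l = Write MEM (state_data t) \<and> rec_trace \<DD> S (var t) (\<eta>(MEM := state_data t)) w b)"
proof -
  have out: "outdeg G (root G) = 1"
    using graph graph_vertex(1) by (simp add: algorithm_graph_def)
  then obtain u where u: "(root G, u) \<in> edges G"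
    by (auto simp: outdeg_def card_1_singleton_iff)
  then have eq: "(x, LPre CTrue (AAsg MEM (DApp (ini sg) (DFlx MEM))) (xv u)) \<in> S"
    by (auto simp: S_def gr2pr_spec_def)
  have "dfun \<DD> (ini sg) d = ifun I (ini sg) d" "ifun I (ini sg) d \<in> Dmain I"
    using data_algebraD(3)[OF algebra] interp_closed(1) assms(1) by auto
  then show ?thesis
    using u outdeg_1_the[OF out u] rec_trace_single[OF eq] edge_verts[OF u] lin_vars_rvars[OF eq] assms(2)
    by auto
qed

text \<open>Inversion of the specification: freshness of \<open>x\<close> and \<open>xe\<close>
  discards their equations, and injectivity of \<open>xv\<close> recovers the vertex from its
  variable.\<close>

lemma vertex_cases:
  assumes "v \<in> verts G" "xv v \<in> rvars S"
  obtains (inner) f u where "f \<in> inner_funs sg" "vlab G v = Some f" "(v, u) \<in> edges G"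
      "(xv v, LPre CTrue (AAsg MEM (DApp f (DFlx MEM))) (xv u)) \<in> S"
  | (test) p u u' where "p \<in> preds sg" "vlab G v = Some p"
      "(v, u) \<in> edges G" "elab G (v, u) = Some True"
      "(v, u') \<in> edges G" "elab G (v, u') = Some False"
      "(xv v, LAlt (LPre (CEqB (BApp p (DFlx MEM)) B1) (AAsg MEM (DFlx MEM)) (xv u))
                   (LPre (CEqB (BApp p (DFlx MEM)) B0) (AAsg MEM (DFlx MEM)) (xv u'))) \<in> S"
  | (final) "vlab G v = Some (fin sg)"
      "(xv v, LPre CTrue (AAsg MEM (DApp (fin sg) (DFlx MEM))) xe) \<in> S"
proof -
  obtain t where t: "(xv v, t) \<in> S" using assms(2) by (auto simp: rvars_def)
  have ne: "xv v \<noteq> x" "xv v \<noteq> xe" and inj: "\<And>u. u \<in> verts G \<Longrightarrow> xv v = xv u \<Longrightarrow> v = u"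
    using fresh assms(1) by (auto simp: fresh_names_def inj_on_def)
  from t consider
      f u where "f \<in> inner_funs sg" "vlab G v = Some f" "(v, u) \<in> edges G"
        "t = LPre CTrue (AAsg MEM (DApp f (DFlx MEM))) (xv u)"
    | p u u' where "p \<in> preds sg" "vlab G v = Some p"
        "(v, u) \<in> edges G" "elab G (v, u) = Some True"
        "(v, u') \<in> edges G" "elab G (v, u') = Some False"
        "t = LAlt (LPre (CEqB (BApp p (DFlx MEM)) B1) (AAsg MEM (DFlx MEM)) (xv u))
                  (LPre (CEqB (BApp p (DFlx MEM)) B0) (AAsg MEM (DFlx MEM)) (xv u'))"
    | "vlab G v = Some (fin sg)" "t = LPre CTrue (AAsg MEM (DApp (fin sg) (DFlx MEM))) xe"
    unfolding S_def gr2pr_spec_def using ne inj by (auto dest: inj)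
  then show thesis using t that by cases blast+
qed

lemma step_mid:
  assumes v: "v \<in> verts G" "xv v \<in> rvars S" and d: "d \<in> Dmain I" and \<eta>: "\<eta> MEM = d"
  shows "\<exists>t. astep (sg, G, I) (StMid v d) = Some t \<and> ok t \<and> t \<notin> range StIn \<and>
    (\<forall>l w b. rec_trace \<DD> S (xv v) \<eta> (l # w) b \<longleftrightarrow>
      l = Write MEM (state_data t) \<and> rec_trace \<DD> S (var t) (\<eta>(MEM := state_data t)) w b)"
  using v
proof (cases rule: vertex_cases)
  case (inner f u)
  then have out: "outdeg G v = 1"
    using graph_vertex(2) v(1) by blast
  have "dfun \<DD> f d = ifun I f d" "ifun I f d \<in> Dmain I"
    using data_algebraD(5)[OF algebra] interp_closed(3) d inner(1) by (simp, blast)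
  then show ?thesis
    using inner outdeg_1_the[OF out inner(3)] rec_trace_single[OF inner(4)] edge_verts[OF inner(3)]
      lin_vars_rvars[OF inner(4)] \<eta>
    by auto
next
  case (test p u u')
  define c where "c = ipred I p d"
  \<comment> \<open>The successor selected by the test value \<open>c\<close>; it is the unique
    vertex described by the definite description in \<open>astep\<close>.\<close>
  define z where "z = (if c then u else u')"
  have out: "outdeg G v = 2" and lab:
    "\<forall>u w. (v, u) \<in> edges G \<and> (v, w) \<in> edges G \<and> u \<noteq> w \<longrightarrow> elab G (v, u) \<noteq> elab G (v, w)"
    using graph_vertex(3)[OF v(1) test(1,2)] by blast+
  have z: "(v, z) \<in> edges G" "elab G (v, z) = Some c"
    using test by (auto simp: z_def)
  have zv: "z \<in> verts G" "xv z \<in> rvars S"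
    using edge_verts[OF z(1)] lin_vars_rvars[OF test(7)] by (auto simp: z_def)
  have "dpred \<DD> p d = c"
    using data_algebraD(6)[OF algebra] d test(1) by (auto simp: c_def)
  \<comment> \<open>Exactly one of the two guards holds. The assignment of \<open>MEM\<close> to
    itself leaves the data alone but still emits a label, so a test is visible in the trace as one
    step.\<close>
  then have "rec_trace \<DD> S (xv v) \<eta> (l # w) b \<longleftrightarrow>
      l = Write MEM d \<and> rec_trace \<DD> S (xv z) (\<eta>(MEM := d)) w b" for l w b
    unfolding rec_trace_Cons[OF test(7)] by (cases c) (simp_all add: z_def \<eta> cong: conj_cong)
  moreover have "astep (sg, G, I) (StMid v d) = Some (StMid z d)"
    using test(1,2) disjoint_labels(1) outdeg_2_the[OF out z lab] by (auto simp: c_def)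
  ultimately show ?thesis using zv d by auto
next
  case final
  have "dfun \<DD> (fin sg) d = ifun I (fin sg) d" "ifun I (fin sg) d \<in> Dout I"
    using data_algebraD(4)[OF algebra] interp_closed(2) d by auto
  then show ?thesis
    using final rec_trace_single[OF final(2)] disjoint_labels \<eta> by auto
qed

lemma step:
  assumes "ok s" "s \<notin> range StOut" "\<eta> MEM = state_data s"
  obtains t where "astep (sg, G, I) s = Some t" "ok t" "t \<notin> range StIn"
    "\<And>l w b. rec_trace \<DD> S (var s) \<eta> (l # w) b \<longleftrightarrow>
      l = Write MEM (state_data t) \<and> rec_trace \<DD> S (var t) (\<eta>(MEM := state_data t)) w b"
proof (cases s)
  case (StIn d)
  with assms step_in[of d \<eta>] show ?thesis using that by auto
next
  case (StMid v d)
  with assms step_mid[of v d \<eta>] show ?thesis using that by auto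
qed (use assms in auto)

text \<open>Makes output states recognizable from traces: immediate termination is possible only at
  \<open>xe\<close>, whose equation is the only one with an \<epsilon> summand.\<close>

lemma accepts_iff:
  assumes "ok s"
  shows "rec_trace \<DD> S (var s) \<eta> [] True \<longleftrightarrow> s \<in> range StOut"
proof (cases s)
  case (StIn d)
  have "\<not> lin_accepts \<DD> \<eta> u" if "(x, u) \<in> S" for u
    using that fresh by (auto simp: S_def gr2pr_spec_def fresh_names_def)
  with StIn show ?thesis by auto
next
  case (StMid v d)
  then have v: "v \<in> verts G" "xv v \<in> rvars S" using assms by auto
  then have "\<not> rec_trace \<DD> S (xv v) \<eta> [] True"
  proof (cases rule: vertex_cases)
    case (inner f u)
    then show ?thesis using equation_unique[OF inner(4)] by simp
  next
    case (test p u u')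
    then show ?thesis using equation_unique[OF test(7)] by simp
  next
    case final
    then show ?thesis using equation_unique[OF final(2)] by simp
  qed
  with StMid show ?thesis by auto
next
  case (StOut d)
  then show ?thesis using rec_trace_xe[of \<eta> "[]" True] by (simp del: rec_trace.simps)
qed

end

section \<open>The simulation relation obtained from equality of traces\<close>

lemma alg_simulation_if_traces_eq:
  fixes G :: "('s, 'v) agraph" and G' :: "('s, 'w) agraph" and S S' :: "('s, 'd, 'm, 'a, 'x) rspec"
  assumes "graph_process sg G I \<DD> MEM x xe xv S Act"
    and "graph_process sg G' I \<DD> MEM x' xe' xv' S' Act"
    and traces: "\<forall>d\<in>Din I. \<exists>\<eta>. \<eta> MEM = d \<and>
      (\<forall>w b. rec_trace \<DD> S x \<eta> w b \<longleftrightarrow> rec_trace \<DD> S' x' \<eta> w b)"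
  shows "\<exists>R. alg_simulation (sg, G, I) (sg, G', I) R"
proof -
  interpret L: graph_process sg G I \<DD> MEM x xe xv S Act by fact
  interpret R: graph_process sg G' I \<DD> MEM x' xe' xv' S' Act by fact
  define same where "same s s' \<eta> \<longleftrightarrow>
    (\<forall>w b. rec_trace \<DD> S (L.var s) \<eta> w b \<longleftrightarrow> rec_trace \<DD> S' (R.var s') \<eta> w b)"
    for s :: "('v, 'd) state" and s' :: "('w, 'd) state" and \<eta>
  \<comment> \<open>Input tags are compared explicitly because traces do not distinguish input
    states from internal ones; output tags need no such clause by \<open>accepts_iff\<close>. A
    single environment witnessing equal traces is enough, since each step merely updates it at
    \<open>MEM\<close>.\<close>
  define Q where "Q s s' \<longleftrightarrow> L.ok s \<and> R.ok s' \<and> state_data s = state_data s' \<and>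
    (s \<in> range StIn \<longleftrightarrow> s' \<in> range StIn) \<and> (\<exists>\<eta>. \<eta> MEM = state_data s \<and> same s s' \<eta>)"
    for s :: "('v, 'd) state" and s' :: "('w, 'd) state"
  have QE: "\<exists>\<eta>. L.ok s \<and> R.ok s' \<and> state_data s = state_data s' \<and>
      (s \<in> range StIn \<longleftrightarrow> s' \<in> range StIn) \<and> (s \<in> range StOut \<longleftrightarrow> s' \<in> range StOut) \<and>
      \<eta> MEM = state_data s \<and> same s s' \<eta>" if Q: "Q s s'" for s s'
  proof -
    from Q obtain \<eta> where \<eta>: "\<eta> MEM = state_data s" "same s s' \<eta>" unfolding Q_def by blast
    moreover have ok: "L.ok s" "R.ok s'" using Q unfolding Q_def by blast+
    moreover have "s \<in> range StOut \<longleftrightarrow> s' \<in> range StOut"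
      using \<eta>(2) unfolding same_def L.accepts_iff[OF ok(1), of \<eta>, symmetric]
        R.accepts_iff[OF ok(2), of \<eta>, symmetric] by blast
    ultimately show ?thesis using Q unfolding Q_def by (intro exI[of _ \<eta>] conjI) (elim conjE, assumption)+
  qed
  have step: "\<exists>t t'. astep (sg, G, I) s = Some t \<and> astep (sg, G', I) s' = Some t' \<and> Q t t'"
    if Q: "Q s s'" for s s'
  proof (cases "s \<in> range StOut")
    case True
    moreover then have "s' \<in> range StOut" using QE[OF Q] by blast
    ultimately show ?thesis using Q by auto
  next
    case False
    obtain \<eta> where \<eta>: "L.ok s" "R.ok s'" "s' \<notin> range StOut" "\<eta> MEM = state_data s"
      "\<eta> MEM = state_data s'" "same s s' \<eta>"
      using QE[OF Q] False by auto
    obtain t where t: "astep (sg, G, I) s = Some t" "L.ok t" "t \<notin> range StIn"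
      "\<And>l w b. rec_trace \<DD> S (L.var s) \<eta> (l # w) b \<longleftrightarrow>
        l = Write MEM (state_data t) \<and> rec_trace \<DD> S (L.var t) (\<eta>(MEM := state_data t)) w b"
      by (rule L.step[where s = s and \<eta> = \<eta>, OF \<eta>(1) False \<eta>(4)]) (rule that)
    obtain t' where t': "astep (sg, G', I) s' = Some t'" "R.ok t'" "t' \<notin> range StIn"
      "\<And>l w b. rec_trace \<DD> S' (R.var s') \<eta> (l # w) b \<longleftrightarrow>
        l = Write MEM (state_data t') \<and> rec_trace \<DD> S' (R.var t') (\<eta>(MEM := state_data t')) w b"
      by (rule R.step[where s = s' and \<eta> = \<eta>, OF \<eta>(2,3,5)]) (rule that)
    have eq: "l = Write MEM (state_data t) \<and> rec_trace \<DD> S (L.var t) (\<eta>(MEM := state_data t)) w b \<longleftrightarrow>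
        l = Write MEM (state_data t') \<and> rec_trace \<DD> S' (R.var t') (\<eta>(MEM := state_data t')) w b"
      for l :: "('d, 'm, 'a) label" and w b
      using \<eta>(6) unfolding same_def t(4)[symmetric] t'(4)[symmetric] by blast
    \<comment> \<open>The incomplete empty trace is always possible, so a one-label trace exists on
      both sides and forces the two labels to be equal.\<close>
    have data: "state_data t = state_data t'"
      using eq[of "Write MEM (state_data t)" "[]" False] by simp
    have "same t t' (\<eta>(MEM := state_data t))"
      unfolding same_def using eq[of "Write MEM (state_data t)"] data by metis
    then have "Q t t'"
      unfolding Q_def using t(2,3) t'(2,3) data fun_upd_same by metis
    then show ?thesis using t(1) t'(1) by blast
  qed
  have In: "Q (StIn d) (StIn d') \<longleftrightarrow> d = d'" if "d \<in> Din I" for d d'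
    using traces that unfolding Q_def same_def
    by (auto simp del: rec_trace.simps)
  \<comment> \<open>After output only the empty trace remains, so output states with equal data have
    equal traces in every environment.\<close>
  have Out: "Q (StOut d) (StOut d') \<longleftrightarrow> d = d'" if "d' \<in> Dout I" for d d'
    using that unfolding Q_def same_def
    by (auto simp: L.rec_trace_xe R.rec_trace_xe simp del: rec_trace.simps)
  have "(s, s') \<in> (StIn ` Din I \<times> StIn ` Din I)
        \<union> ({StMid v d |v d. v \<in> verts G \<and> d \<in> Dmain I} \<times>
           {StMid v d |v d. v \<in> verts G' \<and> d \<in> Dmain I})
        \<union> (StOut ` Dout I \<times> StOut ` Dout I)" if Q: "Q s s'" for s s'
    using QE[OF Q] by (cases s; cases s') auto
  then have "{(s, s'). Q s s'} \<subseteq> (StIn ` Din I \<times> StIn ` Din I)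
        \<union> ({StMid v d |v d. v \<in> verts G \<and> d \<in> Dmain I} \<times>
           {StMid v d |v d. v \<in> verts G' \<and> d \<in> Dmain I})
        \<union> (StOut ` Dout I \<times> StOut ` Dout I)"
    by blast
  moreover have "\<forall>d\<in>Din I. \<exists>!d'. d' \<in> Din I \<and> Q (StIn d) (StIn d')"
    by (auto simp: In)
  moreover have "\<forall>d'\<in>Dout I. \<exists>!d. d \<in> Dout I \<and> Q (StOut d) (StOut d')"
    by (auto simp: Out)
  ultimately have "alg_simulation (sg, G, I) (sg, G', I) {(s, s'). Q s s'}"
    unfolding alg_simulation_def using step by simp
  then show ?thesis by blast
qed

text \<open>By minimality: without input constants the empty set is closed under all operations, so
  it is the whole carrier.\<close>

lemma data_algebra_no_input:
  assumes "data_algebra sg I \<DD>" "Din I = {}"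
  shows "Dout I = {}"
proof -
  have "dcarrier \<DD> = {}"
    using data_algebraD(7)[OF assms(1)] assms(2) by auto
  then show ?thesis using data_algebraD(1)[OF assms(1)] by simp
qed

theorem theorem4:
  fixes sg :: "'s alphabet"
    and G :: "('s, 'v) agraph"
    and G' :: "('s, 'w) agraph"
    and I :: "('s, 'd) interp"
    and \<DD> :: "('s, 'd) dalg"
    and Act :: "'a set"
    and MEM :: 'm
    and den :: "'d \<Rightarrow> ('s, 'd, 'm) dterm"
    and mem_val :: "'d \<Rightarrow> ('s, 'd, 'm) valuation"
    and x x' xe xe' :: 'x
    and xv :: "'v \<Rightarrow> 'x"
    and xv' :: "'w \<Rightarrow> 'x"
  assumes "proto_algorithm (sg, G, I)"
    and "proto_algorithm (sg, G', I)"
    and "data_algebra sg I \<DD>"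
    and "finite Act"
    and "\<forall>d\<in>dcarrier \<DD>. denotes sg I \<DD> (den d) d"
    and "\<forall>d\<in>dcarrier \<DD>. wf_valuation sg I (mem_val d) \<and> mem_val d MEM = den d"
    and "fresh_names G x xv xe"
    and "fresh_names G' x' xv' xe'"
    and "\<forall>d\<in>Din I. derivable sg I \<DD> Act
           (PEval (mem_val d) (gr2pr sg MEM x xv xe G))
           (PEval (mem_val d) (gr2pr sg MEM x' xv' xe' G'))"
  shows "(sg, G, I) \<approx>\<^sub>a (sg, G', I)"
proof (cases "Din I = {}")
  \<comment> \<open>Without inputs the assumed equations are vacuous and do not even give
    well-formed specifications; but then there are no outputs either, and the empty relation is a
    simulation.\<close>
  case True
  then have "Dout I = {}" by (rule data_algebra_no_input[OF assms(3)])
  with True have "alg_simulation (sg, G, I) (sg, G', I) {}" "alg_simulation (sg, G', I) (sg, G, I) {}"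
    by (auto simp: alg_simulation_def)
  then show ?thesis by (auto simp: alg_equiv_def)
next
  case False
  define S :: "('s, 'd, 'm, 'a, 'x) rspec" where "S = gr2pr_spec sg MEM x xv xe G"
  define S' :: "('s, 'd, 'm, 'a, 'x) rspec" where "S' = gr2pr_spec sg MEM x' xv' xe' G'"
  note der = assms(9)[unfolded gr2pr_def, folded S_def S'_def]
  have "lin_rec_spec sg I Act S" "lin_rec_spec sg I Act S'"
    using False der derivable_wf by fastforce+
  then have proc: "graph_process sg G I \<DD> MEM x xe xv S Act"
    "graph_process sg G' I \<DD> MEM x' xe' xv' S' Act"
    using assms(1-3,7,8) S_def S'_def by (simp_all add: graph_process_def)
  have traces: "\<forall>d\<in>Din I. \<exists>\<eta>. \<eta> MEM = d \<and>
      (\<forall>w b. rec_trace \<DD> S x \<eta> w b \<longleftrightarrow> rec_trace \<DD> S' x' \<eta> w b)"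
  proof
    fix d assume d: "d \<in> Din I"
    then have dc: "d \<in> dcarrier \<DD>" using data_algebraD(1)[OF assms(3)] by simp
    \<comment> \<open>The environment in which \<open>PEval (mem_val d)\<close> runs its argument.
      The valuation consists of closed terms, so the constant environment \<open>d\<close> is an
      arbitrary choice within the carrier.\<close>
    define \<eta> where "\<eta> v = deval \<DD> (\<lambda>_. d) (mem_val d v)" for v
    have "\<eta> MEM = d" using assms(5,6) dc by (simp add: \<eta>_def denotes_def)
    moreover have "rec_trace \<DD> S x \<eta> w b \<longleftrightarrow> rec_trace \<DD> S' x' \<eta> w b" for w b
    proof -
      have "env_in (dcarrier \<DD>) (\<lambda>_. d)" using dc by (auto simp: env_in_def)
      from derivable_sound[OF bspec[OF der d] assms(3) this] show ?thesis
        by (simp add: \<eta>_def[abs_def])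
    qed
    ultimately show "\<exists>\<eta>. \<eta> MEM = d \<and>
      (\<forall>w b. rec_trace \<DD> S x \<eta> w b \<longleftrightarrow> rec_trace \<DD> S' x' \<eta> w b)" by blast
  qed
  \<comment> \<open>The same environments witness the exchanged statement, which yields the
    simulation in the other direction.\<close>
  then have "\<forall>d\<in>Din I. \<exists>\<eta>. \<eta> MEM = d \<and>
      (\<forall>w b. rec_trace \<DD> S' x' \<eta> w b \<longleftrightarrow> rec_trace \<DD> S x \<eta> w b)"
    by metis
  then show ?thesis
    unfolding alg_equiv_def
    using alg_simulation_if_traces_eq[OF proc traces] alg_simulation_if_traces_eq[OF proc(2,1)]
    by blast
qed

end
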